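(* For every integer $n\geq 1$, let $B_n$ be the bouquet of $n$ circles. Then its average genus is $$\gamma_{avg}(B_n)=\frac{n+1}{2}-\sum_{m=0}^{n-1} \frac{1+(-1)^m}{2(m+1)}-\frac{1+(-1)^n }{4(n+1)}.$$ In particular, $$\gamma_{avg}(B_n)=\frac{n-\ln n-c+1-\ln 2}{2}+o(1)\quad (n\to\infty),$$ where $c\approx 0.5772$ is the Euler constant.
   Context: Graphs may have loops and multiple edges. The bouquet $B_n$ is the graph with one vertex and $n$ self-loops. For a connected graph $G$, let $g_k(G)$ denote the number of (labeled) cellular embeddings of $G$ into the closed orientable surface of genus $k$ (equivalently, the number of rotation systems of $G$ whose induced embedding has genus $k$; an embedding is cellular if every face is homeomorphic to an open disc). The genus polynomial is $\Gamma_G(x)=\sum_{k\geq 0} g_k(G)x^k$, and the average genus is $\gamma_{avg}(G)=\Gamma_G'(1)/\Gamma_G(1)=\sum_{k\ge 0} k\, g_k(G)/\Gamma_G(1)$, i.e. the expected genus of a uniformly random labeled 2-cell orientable embedding of $G$. *)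

theory Defs
  imports
    "HOL-Analysis.Harmonic_Numbers"
    "HOL-Library.Landau_Symbols"
    "HOL-Computational_Algebra.Polynomial"
    "HOL-Combinatorics.Orbits"
    "Graph_Theory.Bidirected_Digraph"
    "Graph_Theory.Digraph_Component"
begin

text \<open>
  A graph with loops and multiple edges is a \<^locale>\<open>bidirected_digraph\<close> \<open>G\<close>
  with arc reversal \<open>rv\<close>: every undirected edge is a pair \<open>{a, rv a}\<close> of two distinct arcs
  (its two half-edges), also when the edge is a loop.  The half-edges at a vertex \<open>v\<close> are the
  arcs with tail \<open>v\<close>, so a loop occurs there twice.
\<close>

definition edges :: "('v, 'e) pre_digraph \<Rightarrow> ('e \<Rightarrow> 'e) \<Rightarrow> 'e set set" where
  "edges G rv = (\<lambda>a. {a, rv a}) ` arcs G"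

text \<open>
  A rotation system is a cyclic order of the half-edges at each vertex.  The second conjunct
  skips isolated vertices because \<^const>\<open>cyclic_on\<close> never holds for the empty set.
\<close>

definition rotation_systems :: "('v, 'e) pre_digraph \<Rightarrow> ('e \<Rightarrow> 'e) set" where
  "rotation_systems G =
     {\<sigma>. \<sigma> permutes arcs G \<and>
         (\<forall>v \<in> verts G. out_arcs G v \<noteq> {} \<longrightarrow> cyclic_on \<sigma> (out_arcs G v))}"

text \<open>
  Face tracing: traverse an arc \<open>a\<close> to its head, then leave along the successor of \<open>rv a\<close> in
  the rotation there.
\<close>

definition face_boundaries ::
    "('v, 'e) pre_digraph \<Rightarrow> ('e \<Rightarrow> 'e) \<Rightarrow> ('e \<Rightarrow> 'e) \<Rightarrow> 'e set set" where
  "face_boundaries G rv \<sigma> = orbit (\<sigma> \<circ> rv) ` arcs G"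

text \<open>
  The embedding of a single isolated vertex in the sphere has one face, although there are no
  arcs to trace; hence the second summand, which vanishes for every other connected graph.
\<close>

definition num_faces :: "('v, 'e) pre_digraph \<Rightarrow> ('e \<Rightarrow> 'e) \<Rightarrow> ('e \<Rightarrow> 'e) \<Rightarrow> nat" where
  "num_faces G rv \<sigma> =
     card (face_boundaries G rv \<sigma>) + card {v \<in> verts G. out_arcs G v = {}}"

text \<open>
  For connected \<open>G\<close>, the closed orientable surface in which \<open>\<sigma>\<close> embeds \<open>G\<close> cellularly has
  genus \<open>k\<close>, by the Euler formula \<open>V - E + F = 2 - 2 k\<close>.
\<close>

definition has_genus ::
    "('v, 'e) pre_digraph \<Rightarrow> ('e \<Rightarrow> 'e) \<Rightarrow> ('e \<Rightarrow> 'e) \<Rightarrow> nat \<Rightarrow> bool" where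
  "has_genus G rv \<sigma> k \<longleftrightarrow>
     int (card (verts G)) - int (card (edges G rv)) + int (num_faces G rv \<sigma>) = 2 - 2 * int k"

definition num_embeddings :: "('v, 'e) pre_digraph \<Rightarrow> ('e \<Rightarrow> 'e) \<Rightarrow> nat \<Rightarrow> nat" where
  "num_embeddings G rv k = card {\<sigma> \<in> rotation_systems G. has_genus G rv \<sigma> k}"

definition genus_polynomial :: "('v, 'e) pre_digraph \<Rightarrow> ('e \<Rightarrow> 'e) \<Rightarrow> real poly" where
  "genus_polynomial G rv =
     (\<Sum>k | num_embeddings G rv k \<noteq> 0. monom (real (num_embeddings G rv k)) k)"

definition average_genus :: "('v, 'e) pre_digraph \<Rightarrow> ('e \<Rightarrow> 'e) \<Rightarrow> real" where
  "average_genus G rv =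
     poly (pderiv (genus_polynomial G rv)) 1 / poly (genus_polynomial G rv) 1"

text \<open>The index set of the sum in \<^const>\<open>genus_polynomial\<close> is finite:\<close>

lemma finite_num_embeddings_support: "finite {k. num_embeddings G rv k \<noteq> 0}"
proof (rule finite_subset)
  show "{k. num_embeddings G rv k \<noteq> 0} \<subseteq> {..card (edges G rv) + 2}"
  proof
    fix k assume "k \<in> {k. num_embeddings G rv k \<noteq> 0}"
    then have "{\<sigma> \<in> rotation_systems G. has_genus G rv \<sigma> k} \<noteq> {}"
      unfolding num_embeddings_def by (metis (mono_tags, lifting) card.empty mem_Collect_eq)
    then obtain \<sigma> where "has_genus G rv \<sigma> k" by blast
    then show "k \<in> {..card (edges G rv) + 2}" unfolding has_genus_def by simp
  qed
qed simp

lemma coeff_genus_polynomial: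
  "coeff (genus_polynomial G rv) k = real (num_embeddings G rv k)"
proof -
  have "coeff (genus_polynomial G rv) k =
      (\<Sum>j | num_embeddings G rv j \<noteq> 0. if j = k then real (num_embeddings G rv j) else 0)"
    by (simp add: genus_polynomial_def coeff_sum)
  also have "\<dots> = real (num_embeddings G rv k)"
    by (subst sum.delta[OF finite_num_embeddings_support]) auto
  finally show ?thesis .
qed

text \<open>
  The bouquet: the half-edges of the loop \<open>i < n\<close> are \<open>(i, False)\<close> and \<open>(i, True)\<close>.
  The reversal is the identity outside the arcs, as \<^locale>\<open>bidirected_digraph\<close> demands.
\<close>

definition bouquet :: "nat \<Rightarrow> (unit, nat \<times> bool) pre_digraph" where
  "bouquet n = \<lparr>verts = {()}, arcs = {..<n} \<times> UNIV, tail = (\<lambda>_. ()), head = (\<lambda>_. ())\<rparr>"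

definition bouquet_rev :: "nat \<Rightarrow> nat \<times> bool \<Rightarrow> nat \<times> bool" where
  "bouquet_rev n = (\<lambda>(i, b). if i < n then (i, \<not> b) else (i, b))"

lemma bidirected_digraph_bouquet: "bidirected_digraph (bouquet n) (bouquet_rev n)"
  by unfold_locales (auto simp: bouquet_def bouquet_rev_def split: if_splits)

lemma fin_digraph_bouquet: "fin_digraph (bouquet n)"
  by unfold_locales (auto simp: bouquet_def)

lemma connected_bouquet: "Digraph_Component.connected (bouquet n)"
  by (auto simp: Digraph_Component.connected_def strongly_connected_def bouquet_def
      reachable_def)

lemma card_edges_bouquet: "card (edges (bouquet n) (bouquet_rev n)) = n"
proof -
  have "edges (bouquet n) (bouquet_rev n) = (\<lambda>i. {i} \<times> UNIV) ` {..<n}"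
  proof -
    have "{(i, b), bouquet_rev n (i, b)} = {i} \<times> UNIV" if "i < n" for i b
      using that by (auto simp: bouquet_rev_def)
    then show ?thesis
      unfolding edges_def bouquet_def by (force simp: image_iff)
  qed
  moreover have "inj_on (\<lambda>i. {i} \<times> (UNIV :: bool set)) {..<n}"
    by (auto simp: inj_on_def)
  ultimately show ?thesis
    by (simp add: card_image)
qed

end

theory Submission
  imports Defs
begin

text \<open>
  By Euler's formula the genus of a rotation system \<open>\<sigma>\<close> of the bouquet is \<open>(n + 1 - F) / 2\<close>, where
  \<open>F\<close> is the number of cycles of \<open>\<sigma> \<circ> \<tau>\<close>, \<open>\<sigma>\<close> is a full cycle on the \<open>2 n\<close> half-edges and \<open>\<tau>\<close> is
  the fixed-point-free involution that reverses the edges. So the expectation of \<open>F\<close> over all full cycles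
  is needed.

  The indicator of a full cycle is a signed sum over the \<open>\<sigma>\<close>-invariant sets \<open>A\<close> that contain
  a base point, with weight \<open>- (-1) ^ card A\<close> times the sign of the restriction of \<open>\<sigma>\<close> to \<open>A\<close>. Exchanging
  summations replaces full cycles by pairs of arbitrary permutations of \<open>A\<close> and of its complement,
  and the sign kills every \<open>A\<close> with two elements that \<open>\<tau>\<close> moves out of \<open>A\<close>. For the remaining sets,
  unions of edges with at most one extra half-edge, the sum is a product of factorials. This gives
  the expectation as a harmonic number minus an alternating sum with the coefficients
  \<open>(-1) ^ j * (n choose j) / (2 n choose 2 j)\<close>, which satisfy two-term recurrences in \<open>n\<close> and \<open>j\<close>.
\<close>

subsection \<open>Counting cycles of permutations\<close>

text \<open>Points of \<open>D\<close> fixed by \<open>f\<close> count as cycles of length one, so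
  permutations of different subsets of \<open>D\<close> are compared on the same scale.\<close>

definition num_cycles :: "'a set \<Rightarrow> ('a \<Rightarrow> 'a) \<Rightarrow> nat" where
  "num_cycles D f = card (orbit f ` D)"

lemma num_cycles_ident [simp]: "num_cycles D (\<lambda>x. x) = card D"
proof -
  have "orbit (\<lambda>x. x) ` D = (\<lambda>x. {x}) ` D"
    by (intro image_cong refl) (simp add: orbit_eq_singleton_iff)
  then show ?thesis
    by (simp add: num_cycles_def card_image inj_on_def)
qed

lemma num_cycles_id [simp]: "num_cycles D id = card D"
  by (simp add: id_def)

lemma permutes_self_in_orbit: "finite D \<Longrightarrow> f permutes D \<Longrightarrow> x \<in> orbit f x"
  by (metis permutation_permutes permutation_self_in_orbit)

lemma orbit_eq_orbit:
  assumes "finite D" "f permutes D" "y \<in> orbit f x"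
  shows "orbit f y = orbit f x"
  using assms cyclic_on_orbit[OF assms(2,1), of x] by (simp add: orbit_cyclic_eq3)

section \<open>Cycles after multiplication by a transposition\<close>

lemma orbit_comp_transpose:
  assumes "finite D" "f permutes D" "a \<in> D" "b \<in> D" "a \<notin> orbit (Transposition.transpose a b \<circ> f) x"
    "b \<notin> orbit (Transposition.transpose a b \<circ> f) x"
  shows "orbit (Transposition.transpose a b \<circ> f) x = orbit f x"
proof -
  let ?g = "Transposition.transpose a b \<circ> f"
  have g: "?g permutes D" using assms by (intro permutes_compose permutes_swap_id)
  \<comment> \<open>The two maps differ only at points that \<open>f\<close> sends to
    \<open>a\<close> or \<open>b\<close>. There \<open>?g\<close> takes the value \<open>b\<close>
    or \<open>a\<close>, and the orbit avoids both.\<close>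
  have "f s = ?g s" if "s \<in> orbit ?g x" for s
  proof -
    have "?g s \<in> orbit ?g x" using that by (rule orbit.step)
    then have "?g s \<noteq> a" "?g s \<noteq> b" using assms by auto
    then have "f s \<noteq> a" "f s \<noteq> b" by (auto simp: Transposition.transpose_def split: if_splits)
    then show ?thesis by simp
  qed
  then show ?thesis
    by (metis orbit_cong permutes_self_in_orbit[OF assms(1) g])
qed

text \<open>An orbit of the product that meets neither \<open>a\<close> nor \<open>b\<close> is
  unchanged, and any other one is the orbit of \<open>a\<close> or of \<open>b\<close>.\<close>

lemma orbits_comp_transpose_subset:
  assumes "finite D" "f permutes D" "a \<in> D" "b \<in> D"
  shows "orbit (Transposition.transpose a b \<circ> f) ` D \<subseteq> (orbit f ` D - {orbit f a, orbit f b})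
      \<union> {orbit (Transposition.transpose a b \<circ> f) a, orbit (Transposition.transpose a b \<circ> f) b}"
proof
  let ?g = "Transposition.transpose a b \<circ> f"
  have g: "?g permutes D" using assms by (intro permutes_compose permutes_swap_id)
  fix C assume "C \<in> orbit ?g ` D"
  then obtain x where x: "x \<in> D" "C = orbit ?g x" by auto
  show "C \<in> (orbit f ` D - {orbit f a, orbit f b}) \<union> {orbit ?g a, orbit ?g b}"
  proof (cases "a \<in> C \<or> b \<in> C")
    case True
    then have "C = orbit ?g a \<or> C = orbit ?g b"
      using x orbit_eq_orbit[OF assms(1) g] by auto
    then show ?thesis by auto
  next
    case False
    then have "C = orbit f x" using x assms orbit_comp_transpose by metis
    moreover have "a \<in> orbit f a" "b \<in> orbit f b"
      using assms permutes_self_in_orbit by metis+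
    ultimately show ?thesis using False x by auto
  qed
qed

text \<open>At most two orbits are new, and the old orbit of \<open>a\<close> is lost.\<close>

lemma num_cycles_comp_transpose_le:
  assumes "finite D" "f permutes D" "a \<in> D" "b \<in> D"
  shows "num_cycles D (Transposition.transpose a b \<circ> f) \<le> num_cycles D f + 1"
proof -
  let ?g = "Transposition.transpose a b \<circ> f"
  have "num_cycles D ?g \<le> card ((orbit f ` D - {orbit f a}) \<union> {orbit ?g a, orbit ?g b})"
    unfolding num_cycles_def using orbits_comp_transpose_subset[OF assms]
    by (intro card_mono) (use assms in auto)
  also have "\<dots> \<le> card (orbit f ` D - {orbit f a}) + card {orbit ?g a, orbit ?g b}"
    by (rule card_Un_le)
  also have "\<dots> \<le> (num_cycles D f - 1) + 2"
    using assms by (intro add_mono) (auto simp: num_cycles_def card_insert_if)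
  also have "\<dots> = num_cycles D f + 1"
  proof -
    have "num_cycles D f > 0" using assms by (auto simp: num_cycles_def card_gt_0_iff)
    then show ?thesis by simp
  qed
  finally show ?thesis .
qed

text \<open>The transposition splices the fixed point \<open>a\<close> into the cycle of
  \<open>b\<close>, so exactly two cycles merge.\<close>

lemma num_cycles_comp_transpose_fixed:
  assumes "finite D" "f permutes D" "a \<in> D" "b \<in> D" "f a = a" "a \<noteq> b"
  shows "num_cycles D f = num_cycles D (Transposition.transpose a b \<circ> f) + 1"
proof (rule antisym)
  let ?g = "Transposition.transpose a b \<circ> f"
  have g: "?g permutes D" using assms by (intro permutes_compose permutes_swap_id)
  \<comment> \<open>The transposition undoes itself, so the general bound applied to
    \<open>?g\<close> gives this direction.\<close>
  have "Transposition.transpose a b \<circ> ?g = f" by (simp add: fun_eq_iff)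
  with num_cycles_comp_transpose_le[OF assms(1) g assms(3,4)]
  show "num_cycles D f \<le> num_cycles D ?g + 1" by simp
  have "?g a = b" using assms by simp
  then have "b \<in> orbit ?g a" by (metis orbit.base)
  then have ab: "orbit ?g b = orbit ?g a" using orbit_eq_orbit[OF assms(1) g] by simp
  have "orbit f a \<noteq> orbit f b"
  proof -
    have "orbit f a = {a}" using assms by (simp add: orbit_eq_singleton_iff)
    moreover have "b \<in> orbit f b" using assms permutes_self_in_orbit by metis
    ultimately show ?thesis using assms by auto
  qed
  then have c: "card {orbit f a, orbit f b} = 2" by simp
  have "num_cycles D ?g \<le> card ((orbit f ` D - {orbit f a, orbit f b}) \<union> {orbit ?g a})"
    unfolding num_cycles_def using orbits_comp_transpose_subset[OF assms(1-4)] ab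
    by (intro card_mono) (use assms in auto)
  also have "\<dots> \<le> card (orbit f ` D - {orbit f a, orbit f b}) + 1"
    by (metis card_Un_le is_singletonI is_singleton_altdef)
  also have "card (orbit f ` D - {orbit f a, orbit f b}) = num_cycles D f - 2"
    using assms c by (subst card_Diff_subset) (auto simp: num_cycles_def)
  finally have "num_cycles D ?g \<le> num_cycles D f - 2 + 1" .
  moreover have "2 \<le> num_cycles D f"
    using assms unfolding c[symmetric] num_cycles_def by (intro card_mono) auto
  ultimately show "num_cycles D ?g + 1 \<le> num_cycles D f" by simp
qed

text \<open>\<open>g\<close> conjugates \<open>f \<circ> g\<close> to \<open>g \<circ> f\<close> and
  carries orbits to orbits. In later products this allows factors to be rotated cyclically.\<close>

lemma num_cycles_comp_commute:
  assumes "finite D" "f permutes D" "g permutes D"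
  shows "num_cycles D (f \<circ> g) = num_cycles D (g \<circ> f)"
proof -
  have fg: "(f \<circ> g) permutes D" using assms by (intro permutes_compose)
  have im: "g ` orbit (f \<circ> g) x = orbit (g \<circ> f) (g x)" for x
    by (rule orbit_inverse) (use permutes_self_in_orbit[OF assms(1) fg] in auto)
  have "orbit (g \<circ> f) ` D = orbit (g \<circ> f) ` (g ` D)"
    using assms by (simp add: permutes_image)
  also have "\<dots> = (`) g ` (orbit (f \<circ> g) ` D)"
    by (simp add: image_image im)
  also have "card \<dots> = card (orbit (f \<circ> g) ` D)"
    using permutes_inj[OF assms(3)] by (intro card_image) (auto simp: inj_on_def inj_image_eq_iff)
  finally show ?thesis by (simp only: num_cycles_def)
qed

section \<open>Building a permutation by adding one point at a time\<close>

lemma permutes_insertE: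
  assumes "f permutes insert a A"
  obtains b g where "b \<in> insert a A" "g permutes A" "f = Transposition.transpose a b \<circ> g"
proof -
  let ?g = "Transposition.transpose a (f a) \<circ> f"
  have "f = Transposition.transpose a (f a) \<circ> ?g"
    by (simp add: fun_eq_iff)
  then show thesis
    using that[of "f a" ?g] permutes_insert_lemma[OF assms] permutes_in_image[OF assms] by blast
qed

text \<open>Taking points out of their cycles one by one reduces any permutation to the identity.
  Read backwards, each step is a transposition that moves a point fixed so far.\<close>

lemma permutes_fixed_induct [consumes 2, case_names id transpose]:
  assumes "finite A" "f permutes A"
    and "P id"
    and "\<And>f a b. f permutes A \<Longrightarrow> a \<in> A \<Longrightarrow> b \<in> A \<Longrightarrow> a \<noteq> b \<Longrightarrow> f a = a \<Longrightarrow> P f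
        \<Longrightarrow> P (Transposition.transpose a b \<circ> f)"
  shows "P f"
proof -
  have "P f" if "finite B" "f permutes B" "B \<subseteq> A" for B f
    using that
  proof (induction B arbitrary: f rule: finite_induct)
    case empty
    then show ?case using assms(3) by (simp add: id_def)
  next
    case (insert a B)
    obtain b g where g: "b \<in> insert a B" "g permutes B" "f = Transposition.transpose a b \<circ> g"
      by (rule permutes_insertE[OF insert.prems(1)])
    then have "P g" using insert by auto
    moreover have "g permutes A" using g insert permutes_subset by blast
    moreover have "g a = a" using g insert permutes_not_in by metis
    ultimately show ?case
      using assms(4)[of g a b] g insert by (cases "a = b") (auto simp: o_def)
  qed
  then show ?thesis using assms by auto
qed

lemma sign_transpose_comp:
  assumes "finite D" "f permutes D" "a \<noteq> b"
  shows "sign (Transposition.transpose a b \<circ> f) = - sign f"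
proof -
  have "permutation f" using assms permutation_permutes by blast
  then show ?thesis
    using assms by (simp add: sign_compose permutation_swap_id sign_swap_id)
qed

text \<open>Each splice of a fixed point flips the sign and removes one cycle.\<close>

lemma sign_eq_num_cycles:
  assumes "finite D" "f permutes D"
  shows "sign f = (-1) ^ (card D + num_cycles D f)"
  using assms
proof (induction rule: permutes_fixed_induct)
  case id
  then show ?case by (simp add: num_cycles_id)
next
  case (transpose f a b)
  have "num_cycles D f = num_cycles D (Transposition.transpose a b \<circ> f) + 1"
    using transpose assms by (intro num_cycles_comp_transpose_fixed)
  moreover have "sign (Transposition.transpose a b \<circ> f) = - sign f"
    using transpose assms by (intro sign_transpose_comp)
  ultimately show ?case unfolding transpose.IH by (simp add: o_def)
qed

text \<open>Only \<open>s\<close> may be moved by both factors. When \<open>f\<close> is built up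
  point by point, a new point \<open>a\<close> other than \<open>s\<close> lies outside
  \<open>B\<close>, so \<open>h\<close> and \<open>h \<circ> g\<close> both fix it, and splicing it
  in costs each of them one cycle.\<close>

lemma num_cycles_comp_single_intersection:
  assumes "finite A" "finite D" "insert s A \<subseteq> D" "f permutes insert s A" "g permutes B" "B \<subseteq> D" "A \<inter> B = {}"
  shows "num_cycles D (f \<circ> g) + card D = num_cycles D f + num_cycles D g"
  using assms(1,3,4,7)
proof (induction A arbitrary: f rule: finite_induct)
  case empty
  then have "f = id" by simp
  then show ?case by (simp add: num_cycles_id)
next
  case (insert a A)
  show ?case
  proof (cases "a = s")
    case True then show ?thesis using insert by auto
  next
    case False
    have f: "f permutes insert a (insert s A)" using insert by (simp add: insert_commute)
    from f obtain b h where h: "b \<in> insert a (insert s A)" "h permutes (insert s A)" "f = Transposition.transpose a b \<circ> h"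
      by (rule permutes_insertE)
    have IH: "num_cycles D (h \<circ> g) + card D = num_cycles D h + num_cycles D g"
      by (rule insert.IH) (use insert h in auto)
    show ?thesis
    proof (cases "a = b")
      case True then show ?thesis using h IH by (simp add: o_def)
    next
      case ab: False
      have ha: "h a = a" using permutes_not_in[OF h(2)] False insert by auto
      have ga: "g a = a" using permutes_not_in[OF assms(5)] insert by auto
      have hD: "h permutes D" using h insert permutes_subset by (metis insert_subset)
      have gD: "g permutes D" using assms permutes_subset by metis
      have abD: "a \<in> D" "b \<in> D" using h insert by auto
      have 1: "num_cycles D h = num_cycles D (Transposition.transpose a b \<circ> h) + 1"
        using hD abD ab ha assms(2) by (intro num_cycles_comp_transpose_fixed)
      have 2: "num_cycles D (h \<circ> g) = num_cycles D (Transposition.transpose a b \<circ> (h \<circ> g)) + 1"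
        using hD abD ab ha ga gD assms(2)
        by (intro num_cycles_comp_transpose_fixed permutes_compose) auto
      show ?thesis using 1 2 IH h by (simp add: o_def)
    qed
  qed
qed

section \<open>Sums of signs and cycle numbers over all permutations of a set\<close>

lemma sum_permutes_insert:
  fixes h :: "('a \<Rightarrow> 'a) \<Rightarrow> 'b :: comm_monoid_add"
  assumes "finite A" "a \<notin> A"
  shows "(\<Sum>f | f permutes insert a A. h f) =
      (\<Sum>f | f permutes A. h f) + (\<Sum>b\<in>A. \<Sum>f | f permutes A. h (Transposition.transpose a b \<circ> f))"
proof -
  have "(\<Sum>f | f permutes insert a A. h f) =
      (\<Sum>b\<in>insert a A. \<Sum>f | f permutes A. h (Transposition.transpose a b \<circ> f))"
    using sum_over_permutations_insert[OF assms, of h] by simp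
  then show ?thesis using assms by simp
qed

lemma num_cycles_transpose_new:
  assumes "finite D" "insert a A \<subseteq> D" "a \<notin> A" "f permutes A" "b \<in> A"
  shows "num_cycles D f = num_cycles D (Transposition.transpose a b \<circ> f) + 1"
proof -
  have "f permutes D" using assms permutes_subset by blast
  moreover have "f a = a" using assms permutes_not_in by metis
  ultimately show ?thesis
    using assms by (intro num_cycles_comp_transpose_fixed) auto
qed

text \<open>Points outside \<open>A\<close> are fixed, and a random permutation of \<open>A\<close>
  has a harmonic number of cycles on average. In \<open>D\<close> a new point already counts as a
  cycle: leaving it fixed changes nothing, and splicing it next to an element of \<open>A\<close>
  costs one cycle.\<close>

lemma sum_num_cycles:
  assumes "finite D" "A \<subseteq> D"
  shows "(\<Sum>f | f permutes A. real (num_cycles D f)) =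
      fact (card A) * (real (card D) - real (card A) + harm (card A))"
proof -
  have "finite A" using assms finite_subset by auto
  then show ?thesis using assms(2)
  proof (induction A rule: finite_induct)
    case empty
    have "{f::'a \<Rightarrow> 'a. f permutes {}} = {id}" by auto
    then show ?case by (simp add: num_cycles_id harm_expand)
  next
    case (insert a A)
    let ?m = "card A"
    let ?S = "\<Sum>f | f permutes A. real (num_cycles D f)"
    have S: "?S = fact ?m * (real (card D) - real ?m + harm ?m)"
      using insert by simp
    have "(\<Sum>f | f permutes insert a A. real (num_cycles D f)) =
       ?S + (\<Sum>b\<in>A. \<Sum>f | f permutes A. real (num_cycles D f) - 1)"
      unfolding sum_permutes_insert[OF insert(1,2)]
      by (intro arg_cong2[where f=plus] sum.cong refl)
        (simp add: num_cycles_transpose_new[OF assms(1) insert(4,2)])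
    also have "\<dots> = ?S + ?m * (?S - fact ?m)"
      using insert by (simp add: sum_subtractf card_permutations)
    also have "?S + ?m * (?S - fact ?m) = fact (Suc ?m) * (real (card D) - real ?m + harm ?m) - ?m * fact ?m"
      unfolding S by (simp add: algebra_simps)
    also have "\<dots> = fact (Suc ?m) * (real (card D) - real (Suc ?m) + harm (Suc ?m))"
    proof -
      \<comment> \<open>The only division is the cancellation of \<open>1 + x\<close> against the
        new summand of the harmonic number.\<close>
      have "(1 + x) * F * (d - x + h) - x * F = (1 + x) * F * (d - (1 + x) + (h + inverse (1 + x)))"
        if "x \<ge> 0" for x F d h :: real
      proof -
        have "(1 + x) * inverse (1 + x) = 1" using that by simp
        then have "(1 + x) * F * inverse (1 + x) = F" by (metis mult.assoc mult.commute mult_1)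
        moreover have "(1 + x) * F * (d - (1 + x) + (h + inverse (1 + x))) =
            (1 + x) * F * (d - (1 + x) + h) + (1 + x) * F * inverse (1 + x)"
          by (simp only: distrib_left add.assoc)
        ultimately show ?thesis by (simp only:) (simp add: algebra_simps)
      qed
      from this[of "real ?m" "fact ?m" "real (card D)" "harm ?m"] show ?thesis
        by (simp add: harm_Suc)
    qed
    finally show ?case using insert by simp
  qed
qed

text \<open>Multiplication by a fixed transposition is a sign-reversing bijection.\<close>

lemma sum_sign:
  assumes "finite A" "2 \<le> card A"
  shows "(\<Sum>f | f permutes A. sign f) = 0"
proof -
  obtain a b where ab: "a \<in> A" "b \<in> A" "a \<noteq> b"
    using card_le_Suc0_iff_eq[OF assms(1)] assms(2) by auto
  have "(\<Sum>f | f permutes A. sign f) = (\<Sum>f | f permutes A. sign (Transposition.transpose a b \<circ> f))"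
    using ab by (intro setum_permutations_compose_left permutes_swap_id)
  also have "\<dots> = (\<Sum>f | f permutes A. - sign f)"
    using ab assms by (intro sum.cong refl sign_transpose_comp) auto
  finally show ?thesis by (simp add: sum_negf)
qed

text \<open>The recurrence is that of the unsigned sum, with a sign change for each splice. Once the
  sum of the signs vanishes, a new point multiplies the sum by one minus the current size, whence
  the factorial.\<close>

lemma sum_sign_num_cycles:
  assumes "finite D" "A \<subseteq> D" "2 \<le> card A"
  shows "(\<Sum>f | f permutes A. sign f * int (num_cycles D f)) = (-1) ^ card A * fact (card A - 2)"
proof -
  \<comment> \<open>Sizes 0 and 1 are needed as starting values; there the sum of the signs is 1 and
    not 0.\<close>
  have gen: "(\<Sum>f | f permutes A. sign f * int (num_cycles D f)) =
      (if card A = 0 then int (card D) else if card A = 1 then int (card D)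
       else (-1) ^ card A * fact (card A - 2))"
    if "finite A" "A \<subseteq> D" for A
    using that
  proof (induction A rule: finite_induct)
    case empty
    have "{f::'a \<Rightarrow> 'a. f permutes {}} = {id}" by auto
    then show ?case by (simp add: num_cycles_id)
  next
    case (insert a A)
    let ?m = "card A"
    let ?S = "\<Sum>f | f permutes A. sign f * int (num_cycles D f)"
    have *: "sign (Transposition.transpose a b \<circ> f) * int (num_cycles D (Transposition.transpose a b \<circ> f))
        = sign f - sign f * int (num_cycles D f)" if "b \<in> A" "f permutes A" for b f
    proof -
      have "a \<noteq> b" using that insert by auto
      then have "sign (Transposition.transpose a b \<circ> f) = - sign f"
        using that insert by (intro sign_transpose_comp)
      then show ?thesis
        using num_cycles_transpose_new[OF assms(1) insert(4,2) that(2,1)] by (simp add: algebra_simps)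
    qed
    have "(\<Sum>f | f permutes insert a A. sign f * int (num_cycles D f)) =
       ?S + (\<Sum>b\<in>A. \<Sum>f | f permutes A. sign f - sign f * int (num_cycles D f))"
      unfolding sum_permutes_insert[OF insert(1,2)]
      by (intro arg_cong2[where f=plus] sum.cong refl) (auto simp: *)
    also have "\<dots> = ?S + ?m * ((\<Sum>f | f permutes A. sign f) - ?S)"
      by (simp add: sum_subtractf)
    finally have rec: "(\<Sum>f | f permutes insert a A. sign f * int (num_cycles D f)) =
        ?S + ?m * ((\<Sum>f | f permutes A. sign f) - ?S)" .
    consider "?m = 0" | "?m = 1" | "?m \<ge> 2" by linarith
    then show ?case
    proof cases
      case 1
      then show ?thesis using rec insert by simp
    next
      case 2
      then obtain x where "A = {x}" by (auto simp: card_1_singleton_iff)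
      then have "{f. f permutes A} = {id}" by auto
      then show ?thesis using rec insert 2 by simp
    next
      case 3
      then obtain k where "card A = Suc (Suc k)" by (metis add_2_eq_Suc le_iff_add)
      then show ?thesis using rec insert 3 sum_sign[of A]
        by (auto simp: algebra_simps)
    qed
  qed
  show ?thesis using gen[of A] assms finite_subset[OF assms(2,1)] by auto
qed

subsection \<open>Full cycles as signed sums\<close>

lemma perm_restrict_permutes:
  assumes "finite A" "f permutes D" "f ` A \<subseteq> A"
  shows "perm_restrict f A permutes A"
proof (rule bij_imp_permutes)
  have "inj_on f A" using permutes_inj[OF assms(2)] by (rule inj_on_subset) simp
  then have "bij_betw f A A"
    using assms by (simp add: bij_betw_def endo_inj_surj)
  then show "bij_betw (perm_restrict f A) A A"
    by (rule bij_betw_cong[THEN iffD1, rotated]) (simp add: perm_restrict_simps)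
qed (simp add: perm_restrict_simps)

lemma invariant_orbit_subset:
  assumes "f ` A \<subseteq> A" "x \<in> A"
  shows "orbit f x \<subseteq> A"
proof
  fix y assume "y \<in> orbit f x"
  then show "y \<in> A" by induct (use assms in auto)
qed

text \<open>The sign of the restriction has the parity of \<open>card A\<close> plus the cycle
  number, so the extra factor leaves the cycles alone.\<close>

lemma sign_perm_restrict:
  assumes "finite D" "f permutes D" "A \<subseteq> D" "f ` A \<subseteq> A"
  shows "(-1) ^ card A * sign (perm_restrict f A) = (-1) ^ num_cycles A f"
proof -
  have A: "finite A" using assms finite_subset by auto
  have "orbit (perm_restrict f A) ` A = orbit f ` A"
    by (intro image_cong refl orbit_cong0[where A=A])
      (use assms in \<open>auto simp: perm_restrict_simps\<close>)
  then have "sign (perm_restrict f A) = (-1) ^ (card A + num_cycles A f)"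
    using sign_eq_num_cycles[OF A perm_restrict_permutes[OF A assms(2,4)]]
    by (simp add: num_cycles_def)
  then show ?thesis by (simp add: power_add flip: mult.assoc power_mult_distrib)
qed

text \<open>The terms of the sum are \<open>(-1)\<close> to the number of cycles in \<open>A\<close>, and \<open>A\<close> ranges over the unions
  of cycles that include the cycle of \<open>x\<close>.\<close>

lemma sum_invariant_subsets:
  assumes "finite D" "f permutes D" "x \<in> D"
  shows "(\<Sum>A | A \<subseteq> D \<and> x \<in> A \<and> f ` A \<subseteq> A. (-1) ^ card A * sign (perm_restrict f A)) =
    (if cyclic_on f D then -1 else 0)"
proof -
  note self = permutes_self_in_orbit[OF assms(1,2)]
  note eq = orbit_eq_orbit[OF assms(1,2)]
  note sub = permutes_orbit_subset[OF assms(2)]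
  \<comment> \<open>An invariant set containing \<open>x\<close> is determined by its cycles other
    than that of \<open>x\<close>, and every subset of \<open>?R\<close> occurs. The cycle of
    \<open>x\<close> contributes the constant minus sign.\<close>
  let ?R = "orbit f ` D - {orbit f x}"
  have "(\<Sum>A | A \<subseteq> D \<and> x \<in> A \<and> f ` A \<subseteq> A. (-1) ^ card A * sign (perm_restrict f A)) =
      (\<Sum>S\<in>Pow ?R. - ((-1) ^ card S))"
  proof (rule sum.reindex_bij_witness[where i="\<lambda>S. \<Union>S \<union> orbit f x" and
        j="\<lambda>A. orbit f ` A - {orbit f x}"])
    fix A assume "A \<in> {A. A \<subseteq> D \<and> x \<in> A \<and> f ` A \<subseteq> A}"
    then have A: "A \<subseteq> D" "x \<in> A" "f ` A \<subseteq> A" by auto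
    have "orbit f y \<subseteq> A" if "y \<in> A" for y
      using invariant_orbit_subset[OF A(3) that] .
    then have 1: "\<Union> (orbit f ` A - {orbit f x}) \<union> orbit f x \<subseteq> A"
      using A(2) by auto
    have 2: "A \<subseteq> \<Union> (orbit f ` A - {orbit f x}) \<union> orbit f x"
    proof
      fix y assume "y \<in> A"
      then show "y \<in> \<Union> (orbit f ` A - {orbit f x}) \<union> orbit f x"
        using self[of y] by (cases "orbit f y = orbit f x") auto
    qed
    show "\<Union> (orbit f ` A - {orbit f x}) \<union> orbit f x = A"
      using 1 2 by (rule equalityI)
    show "orbit f ` A - {orbit f x} \<in> Pow ?R" using A by auto
    have "finite A" using A assms finite_subset by auto
    then have "num_cycles A f = Suc (card (orbit f ` A - {orbit f x}))"
      unfolding num_cycles_def using A by (subst card_Suc_Diff1) auto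
    then show "- ((-1) ^ card (orbit f ` A - {orbit f x})) = (-1) ^ card A * sign (perm_restrict f A)"
      using sign_perm_restrict[OF assms(1,2) A(1,3)] by simp
  next
    fix S assume "S \<in> Pow ?R"
    then have S: "S \<subseteq> orbit f ` D" "orbit f x \<notin> S" by auto
    have "\<Union>S \<subseteq> D" using S sub by blast
    moreover have "orbit f x \<subseteq> D" using sub assms by blast
    moreover have "f ` \<Union>S \<subseteq> \<Union>S"
    proof clarify
      fix y C assume "y \<in> C" "C \<in> S"
      then obtain z where "C = orbit f z" using S by auto
      then show "f y \<in> \<Union>S" using \<open>y \<in> C\<close> \<open>C \<in> S\<close> orbit.step[of y f z] by blast
    qed
    moreover have "f ` orbit f x \<subseteq> orbit f x" by (auto intro: orbit.step)
    ultimately show "\<Union>S \<union> orbit f x \<in> {A. A \<subseteq> D \<and> x \<in> A \<and> f ` A \<subseteq> A}"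
      using self[of x] by (simp add: image_Un le_supI1 le_supI2)
    show "orbit f ` (\<Union>S \<union> orbit f x) - {orbit f x} = S"
    proof (intro equalityI subsetI)
      fix C assume "C \<in> orbit f ` (\<Union>S \<union> orbit f x) - {orbit f x}"
      then obtain z where z: "C = orbit f z" "z \<in> \<Union>S \<union> orbit f x" "C \<noteq> orbit f x" by auto
      then have "z \<in> \<Union>S" using eq by auto
      then obtain y where "z \<in> orbit f y" "orbit f y \<in> S" using S by blast
      then show "C \<in> S" using eq z by auto
    next
      fix C assume C: "C \<in> S"
      then obtain z where "C = orbit f z" using S by auto
      then show "C \<in> orbit f ` (\<Union>S \<union> orbit f x) - {orbit f x}"
        using self[of z] C S by blast
    qed
  qed
  \<comment> \<open>The alternating sum over the subsets of \<open>?R\<close> is an expanded product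
    of zeros. It is nonzero only if the product is empty, that is, if the cycle of \<open>x\<close>
    is all of \<open>D\<close>.\<close>
  also have "\<dots> = - (\<Prod>C\<in>?R. 1 - 1)"
    using prod_diff_conv_sum[of ?R "\<lambda>_. 1 :: int" "\<lambda>_. 1"] assms(1) by (simp add: sum_negf)
  also have "\<dots> = (if cyclic_on f D then -1 else 0)"
  proof -
    have "cyclic_on f D \<longleftrightarrow> ?R = {}"
    proof
      assume "cyclic_on f D"
      then show "?R = {}" using assms orbit_cyclic_eq3 by fastforce
    next
      assume "?R = {}"
      then have "orbit f y = orbit f x" if "y \<in> D" for y using that by auto
      then have "D \<subseteq> orbit f x" using self by (metis subsetI)
      then have "D = orbit f x" using sub[OF assms(3)] by auto
      then show "cyclic_on f D" using assms unfolding cyclic_on_def by blast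
    qed
    moreover have "- (\<Prod>C\<in>R. 1 - 1) = (if b then -1 else (0::int))"
      if "finite R" "b \<longleftrightarrow> R = {}" for b and R :: "'a set set"
      using that by (auto simp: power_0_left)
    ultimately show ?thesis using assms(1) by simp
  qed
  finally show ?thesis .
qed

text \<open>A permutation preserving \<open>A\<close> is the product of its restrictions to
  \<open>A\<close> and to \<open>D - A\<close>, and these range independently.\<close>

lemma sum_permutes_invariant:
  fixes h :: "('a \<Rightarrow> 'a) \<Rightarrow> real"
  assumes "finite D" "A \<subseteq> D"
  shows "(\<Sum>f | f permutes D \<and> f ` A \<subseteq> A. sign (perm_restrict f A) * h f) =
    (\<Sum>f | f permutes A. \<Sum>g | g permutes D - A. sign f * h (f \<circ> g))"
proof -
  have A: "finite A" "finite (D - A)" using assms finite_subset by auto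
  have "(\<Sum>f | f permutes D \<and> f ` A \<subseteq> A. sign (perm_restrict f A) * h f) =
    (\<Sum>(f, g) \<in> {f. f permutes A} \<times> {g. g permutes D - A}. sign f * h (f \<circ> g))"
  proof (rule sum.reindex_bij_witness[where i="\<lambda>(f, g). f \<circ> g" and
        j="\<lambda>f. (perm_restrict f A, perm_restrict f (D - A))"], safe)
    fix f assume f: "f permutes D" "f ` A \<subseteq> A"
    \<comment> \<open>By finiteness and injectivity the inclusion is an equality, hence the
      complement is preserved as well.\<close>
    have "f ` A = A"
      using f A permutes_inj_on[OF f(1)] by (simp add: endo_inj_surj)
    then have "f ` (D - A) \<subseteq> D - A"
      using f permutes_image[OF f(1)] permutes_inj[OF f(1)] by (auto simp: image_set_diff)
    then show *: "perm_restrict f (D - A) permutes D - A" "perm_restrict f A permutes A"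
      using f A perm_restrict_permutes by blast+
    show "perm_restrict f A \<circ> perm_restrict f (D - A) = f"
      using perm_restrict_union[OF *(2,1)] f assms by (simp add: Un_absorb1)
    then show "sign (perm_restrict f A) * h (perm_restrict f A \<circ> perm_restrict f (D - A)) =
       sign (perm_restrict f A) * h f" by simp
  next
    fix f g assume fg: "f permutes A" "g permutes D - A"
    show "f \<circ> g permutes D"
      using fg permutes_subset[OF fg(1) assms(2)] permutes_subset[OF fg(2), of D]
      by (intro permutes_compose) auto
    have g: "g y = y" if "y \<in> A" for y using permutes_not_in[OF fg(2)] that by auto
    then show "(f \<circ> g) y \<in> A" if "y \<in> A" for y
      using permutes_in_image[OF fg(1)] that by simp
    show "perm_restrict (f \<circ> g) A = f"
      using g permutes_not_in[OF fg(1)] by (auto simp: perm_restrict_def fun_eq_iff)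
    have "f (g y) = g y" if "y \<in> D - A" for y
      using that permutes_in_image[OF fg(2)] permutes_not_in[OF fg(1)] by auto
    then show "perm_restrict (f \<circ> g) (D - A) = g"
      using permutes_not_in[OF fg(2)] by (auto simp: perm_restrict_def fun_eq_iff)
  qed
  then show ?thesis by (simp add: sum.cartesian_product)
qed

text \<open>The indicator of a full cycle is replaced by the signed sum over invariant sets. After
  the sums are exchanged, the inner one runs over the permutations that preserve a given
  \<open>A\<close>.\<close>

lemma sum_cyclic_on:
  fixes h :: "('a \<Rightarrow> 'a) \<Rightarrow> real"
  assumes "finite D" "x \<in> D"
  shows "(\<Sum>f | f permutes D \<and> cyclic_on f D. h f) =
    - (\<Sum>A | A \<subseteq> D \<and> x \<in> A. (-1) ^ card A *
        (\<Sum>f | f permutes A. \<Sum>g | g permutes D - A. sign f * h (f \<circ> g)))"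
proof -
  have fin: "finite {f. f permutes D}" using assms finite_permutations by blast
  have finA: "finite {A. A \<subseteq> D \<and> x \<in> A}" using assms by simp
  have "- (\<Sum>A | A \<subseteq> D \<and> x \<in> A. (-1) ^ card A *
        (\<Sum>f | f permutes A. \<Sum>g | g permutes D - A. sign f * h (f \<circ> g))) =
    - (\<Sum>A | A \<subseteq> D \<and> x \<in> A. (-1) ^ card A *
        (\<Sum>f | f permutes D \<and> f ` A \<subseteq> A. sign (perm_restrict f A) * h f))"
    using assms by (intro arg_cong[where f=uminus] sum.cong refl) (simp add: sum_permutes_invariant)
  also have "\<dots> = - (\<Sum>A | A \<subseteq> D \<and> x \<in> A.
        (\<Sum>f | f permutes D \<and> f ` A \<subseteq> A. of_int ((-1) ^ card A * sign (perm_restrict f A)) * h f))"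
    by (simp add: sum_distrib_left mult.assoc)
  also have "\<dots> = - (\<Sum>f | f permutes D. \<Sum>A | A \<subseteq> D \<and> x \<in> A \<and> f ` A \<subseteq> A.
       of_int ((-1) ^ card A * sign (perm_restrict f A)) * h f)"
    using sum.swap_restrict[OF finA fin, of "\<lambda>A f. of_int ((-1) ^ card A * sign (perm_restrict f A)) * h f"
        "\<lambda>A f. f ` A \<subseteq> A"]
    by (simp add: conj_assoc)
  also have "\<dots> = - (\<Sum>f | f permutes D. of_int (if cyclic_on f D then -1 else 0) * h f)"
    unfolding sum_distrib_right[symmetric] of_int_sum[symmetric]
    by (intro arg_cong[where f=uminus] sum.cong refl) (subst sum_invariant_subsets, use assms in auto)
  also have "\<dots> = (\<Sum>f | f permutes D. if cyclic_on f D then h f else 0)"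
    unfolding sum_negf[symmetric] by (intro sum.cong refl) simp
  also have "\<dots> = (\<Sum>f | f permutes D \<and> cyclic_on f D. h f)"
    using sum.inter_filter[OF fin, of h "\<lambda>f. cyclic_on f D"] by simp
  finally show ?thesis by simp
qed

lemma sum_singleton_permutes: "(\<Sum>f | f permutes {a}. h f) = h id"
proof -
  have "{f. f permutes {a}} = {id}" by auto
  then show ?thesis by simp
qed

text \<open>For constant \<open>h\<close> the sum of the signs vanishes on every \<open>A\<close>
  with two elements or more. Only \<open>{x}\<close> remains, with all permutations of the other
  points.\<close>

lemma card_cyclic_on:
  assumes "finite D" "D \<noteq> {}"
  shows "card {f. f permutes D \<and> cyclic_on f D} = fact (card D - 1)"
proof -
  obtain x where x: "x \<in> D" using assms by auto
  have zero: "(\<Sum>f | f permutes A. \<Sum>g | g permutes D - A. real_of_int (sign f) * 1) = 0"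
    if sub: "A \<subseteq> D" "x \<in> A" "A \<noteq> {x}" for A
  proof -
    have A: "finite A" using sub assms finite_subset by auto
    obtain y where y: "y \<in> A" "y \<noteq> x" using sub(2,3) by blast
    then have "card {x, y} \<le> card A"
      using A sub by (intro card_mono) auto
    then have "2 \<le> card A" using y by simp
    then have "of_int (\<Sum>f | f permutes A. sign f) = (0::real)"
      using sum_sign[OF A] by simp
    then show ?thesis by (simp add: sum_distrib_left[symmetric])
  qed
  have "real (card {f. f permutes D \<and> cyclic_on f D}) = (\<Sum>f | f permutes D \<and> cyclic_on f D. (1::real))"
    by simp
  also have "\<dots> = - (\<Sum>A | A \<subseteq> D \<and> x \<in> A. (-1) ^ card A *
        (\<Sum>f | f permutes A. \<Sum>g | g permutes D - A. real_of_int (sign f) * 1))"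
    by (rule sum_cyclic_on[OF assms(1) x])
  also have "\<dots> = - (\<Sum>A \<in> {{x}}. (-1) ^ card A *
        (\<Sum>f | f permutes A. \<Sum>g | g permutes D - A. real_of_int (sign f) * 1))"
    by (intro arg_cong[where f=uminus] sum.mono_neutral_right) (use x assms zero in auto)
  also have "\<dots> = fact (card D - 1)"
    using x assms by (simp add: sum_singleton_permutes card_permutations)
  finally show ?thesis by (metis of_nat_eq_iff of_nat_fact)
qed

section \<open>The contribution of a single subset\<close>

lemma transpose_image_comp:
  assumes "inj f"
  shows "Transposition.transpose (f a) (f b) \<circ> f = f \<circ> Transposition.transpose a b"
  using assms by (auto simp: fun_eq_iff Transposition.transpose_def inj_def)

text \<open>The contribution of \<open>A\<close> to the sum of the cycle numbers of \<open>f \<circ> t\<close> over all full cycles \<open>f\<close>,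
  up to the sign \<open>- (-1) ^ card A\<close>.\<close>

definition signed_sum_cycles :: "'a set \<Rightarrow> ('a \<Rightarrow> 'a) \<Rightarrow> 'a set \<Rightarrow> real" where
  "signed_sum_cycles D t A =
    (\<Sum>f | f permutes A. \<Sum>g | g permutes D - A. sign f * real (num_cycles D (f \<circ> g \<circ> t)))"

text \<open>Conjugation by the transposition of \<open>a\<close> and \<open>b\<close> preserves the cycle number but flips the sign.\<close>

lemma signed_sum_cycles_eq_0:
  assumes "finite D" "t permutes D" "A \<subseteq> D" "a \<in> A" "b \<in> A" "a \<noteq> b" "t a \<notin> A" "t b \<notin> A"
  shows "signed_sum_cycles D t A = 0"
proof -
  let ?u = "Transposition.transpose a b" and ?v = "Transposition.transpose (t a) (t b)"
  have A: "finite A" using assms finite_subset by auto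
  have sub: "f permutes D" if "f permutes A" for f using that assms permutes_subset by blast
  have sub': "f permutes D" if "f permutes D - A" for f using that permutes_subset by blast
  have v: "?v permutes D - A"
    using assms permutes_in_image[OF assms(2)] by (intro permutes_swap_id) auto
  have u: "?u permutes A" using assms by (intro permutes_swap_id)
  have vt: "?v \<circ> t = t \<circ> ?u" using permutes_inj[OF assms(2)] by (rule transpose_image_comp)
  let ?h = "\<lambda>f. \<Sum>g | g permutes D - A. sign f * real (num_cycles D (f \<circ> g \<circ> t))"
  have "?h f = - ?h (?u \<circ> f)" if f: "f permutes A" for f
  proof -
    \<comment> \<open>The sum over \<open>g\<close> absorbs \<open>?v\<close>, because
      \<open>t a\<close> and \<open>t b\<close> lie outside \<open>A\<close>. Passing
      \<open>t\<close> turns \<open>?v\<close> into \<open>?u\<close>, which a cyclic rotation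
      brings in front of \<open>f\<close>.\<close>
    have "?h f = (\<Sum>g | g permutes D - A. sign f * real (num_cycles D (f \<circ> (g \<circ> ?v) \<circ> t)))"
      by (rule sum_permutations_compose_right[OF v])
    also have "\<dots> = (\<Sum>g | g permutes D - A. sign f * real (num_cycles D (?u \<circ> f \<circ> g \<circ> t)))"
    proof (intro sum.cong refl)
      fix g assume "g \<in> {g. g permutes D - A}"
      then have "num_cycles D ((f \<circ> g \<circ> t) \<circ> ?u) = num_cycles D (?u \<circ> (f \<circ> g \<circ> t))"
        using assms(1,2) sub[OF f] sub[OF u] sub'[of g]
        by (intro num_cycles_comp_commute permutes_compose) auto
      moreover have "f \<circ> (g \<circ> ?v) \<circ> t = (f \<circ> g \<circ> t) \<circ> ?u"
        using vt by (simp add: fun_eq_iff)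
      ultimately show "sign f * real (num_cycles D (f \<circ> (g \<circ> ?v) \<circ> t)) =
          sign f * real (num_cycles D (?u \<circ> f \<circ> g \<circ> t))"
        by (simp only: o_assoc)
    qed
    also have "\<dots> = - ?h (?u \<circ> f)"
      unfolding sum_negf[symmetric]
      by (intro sum.cong refl)
        (simp only: sign_transpose_comp[OF A f assms(6)] of_int_minus mult_minus_left minus_minus)
    finally show ?thesis .
  qed
  then have "sum ?h {f. f permutes A} = (\<Sum>f | f permutes A. - ?h (?u \<circ> f))"
    by (intro sum.cong) auto
  also have "\<dots> = - (\<Sum>f | f permutes A. ?h (?u \<circ> f))" by (rule sum_negf)
  also have "(\<Sum>f | f permutes A. ?h (?u \<circ> f)) = sum ?h {f. f permutes A}"
    by (rule setum_permutations_compose_left[OF u, symmetric])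
  finally have "sum ?h {f. f permutes A} = 0" by linarith
  then show ?thesis by (simp only: signed_sum_cycles_def)
qed

text \<open>Here \<open>f\<close> is the identity and \<open>g\<close> fixes \<open>a\<close>. Since
  \<open>t = ?u \<circ> ?s\<close> with \<open>?s\<close> fixing \<open>a\<close>, the factor
  \<open>?u\<close> splices \<open>a\<close> into a cycle of \<open>?s \<circ> g\<close> at the cost
  of one cycle. The sum over \<open>g\<close> absorbs \<open>?s\<close>, and the unsigned sum of
  cycle numbers remains.\<close>

lemma signed_sum_cycles_singleton:
  assumes "finite D" "t permutes D" "a \<in> D" "t a \<noteq> a"
  shows "signed_sum_cycles D t {a} = fact (card D - 1) * harm (card D - 1)"
proof -
  let ?B = "D - {a}"
  let ?u = "Transposition.transpose a (t a)"
  let ?s = "?u \<circ> t"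
  have ta: "t a \<in> D" using assms permutes_in_image by metis
  have "?s permutes insert a ?B" using assms ta
    by (intro permutes_compose permutes_swap_id) (auto simp: insert_absorb)
  then have s: "?s permutes ?B"
    by (metis permutes_insert_lemma assms(2,3) insert_Diff)
  have u: "?u permutes D" using assms ta by (intro permutes_swap_id)
  have sub: "f permutes D" if "f permutes ?B" for f using that permutes_subset by blast
  have t: "t = ?u \<circ> ?s" by (simp add: fun_eq_iff)
  have *: "num_cycles D (g \<circ> t) = real (num_cycles D (?s \<circ> g)) - 1" if g: "g permutes ?B" for g
  proof -
    have "num_cycles D (g \<circ> t) = num_cycles D ((g \<circ> ?u) \<circ> ?s)"
      using t by (metis o_assoc)
    also have "\<dots> = num_cycles D (?s \<circ> (g \<circ> ?u))"
      using assms sub[OF s] sub[OF g] u by (intro num_cycles_comp_commute permutes_compose)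
    also have "\<dots> = num_cycles D ((?s \<circ> g) \<circ> ?u)" by (simp only: o_assoc)
    also have "\<dots> = num_cycles D (?u \<circ> (?s \<circ> g))"
      using assms sub[OF s] sub[OF g] u by (intro num_cycles_comp_commute permutes_compose)
    finally have 1: "num_cycles D (g \<circ> t) = num_cycles D (?u \<circ> (?s \<circ> g))" .
    have "g a = a" using permutes_not_in[OF g] by simp
    moreover have "?s a = a" using permutes_not_in[OF s] by simp
    ultimately have "num_cycles D (?s \<circ> g) = num_cycles D (?u \<circ> (?s \<circ> g)) + 1"
      using num_cycles_comp_transpose_fixed[OF assms(1) permutes_compose[OF sub[OF g] sub[OF s]]
          assms(3) ta] assms(4) by simp
    with 1 show ?thesis by simp
  qed
  have "signed_sum_cycles D t {a} = (\<Sum>g | g permutes ?B. real (num_cycles D (g \<circ> t)))"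
    by (simp add: signed_sum_cycles_def sum_singleton_permutes)
  also have "\<dots> = (\<Sum>g | g permutes ?B. real (num_cycles D (?s \<circ> g)) - 1)"
    by (intro sum.cong refl) (simp add: *)
  also have "\<dots> = (\<Sum>g | g permutes ?B. real (num_cycles D g) - 1)"
    by (rule setum_permutations_compose_left[OF s, symmetric])
  also have "\<dots> = fact (card ?B) * (real (card D) - real (card ?B) + harm (card ?B)) - fact (card ?B)"
    using assms by (simp add: sum_subtractf sum_num_cycles card_permutations del: card_Diff_insert card_Diff_singleton)
  also have "\<dots> = fact (card D - 1) * harm (card D - 1)"
  proof -
    have "card ?B = card D - 1" "card D \<ge> 1"
      using assms by (auto simp: Suc_le_eq card_gt_0_iff)
    then show ?thesis by (simp add: of_nat_diff algebra_simps)
  qed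
  finally show ?thesis .
qed

text \<open>After a cyclic shift of factors, \<open>f \<circ> g \<circ> t\<close> becomes a product of a permutation of \<open>A\<close> and a
  permutation of \<open>D - P\<close>. These two sets share at most the point \<open>s\<close>, so the cycle number is
  additive.\<close>

lemma signed_sum_cycles_invariant:
  assumes "finite D" "p permutes P" "r permutes D - P" "t = r \<circ> p" "A = insert s P" "A \<subseteq> D" "2 \<le> card A"
  shows "signed_sum_cycles D t A =
    sign p * (-1) ^ card A * fact (card A - 2) * fact (card D - card A)"
proof -
  have fin: "finite A" "finite P" using assms finite_subset by auto
  have pA: "p permutes A" using assms permutes_subset by blast
  have sub: "f permutes D" if "f permutes A" for f using that assms permutes_subset by blast
  have sub': "f permutes D" if "f permutes D - P" for f using that permutes_subset by blast
  have sub'': "f permutes D - P" if "f permutes D - A" for f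
    by (rule permutes_subset[OF that]) (use assms in auto)
  have cyc: "real (num_cycles D (f \<circ> g \<circ> t)) =
      real (num_cycles D (p \<circ> f)) + (real (num_cycles D (g \<circ> r)) - real (card D))"
    if f: "f permutes A" and g: "g permutes D - A" for f g
  proof -
    have gr: "g \<circ> r permutes D - P"
      using sub''[OF g] assms by (intro permutes_compose)
    have "num_cycles D (f \<circ> g \<circ> t) = num_cycles D ((f \<circ> (g \<circ> r)) \<circ> p)"
      using assms by (simp only: o_assoc)
    also have "\<dots> = num_cycles D (p \<circ> (f \<circ> (g \<circ> r)))"
      using num_cycles_comp_commute[OF assms(1) permutes_compose[OF sub'[OF gr] sub[OF f]] sub[OF pA]] .
    also have "\<dots> = num_cycles D ((p \<circ> f) \<circ> (g \<circ> r))"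
      by (simp only: o_assoc)
    also have "real \<dots> = num_cycles D (p \<circ> f) + (real (num_cycles D (g \<circ> r)) - card D)"
    proof -
      have "p \<circ> f permutes insert s P"
        using pA f assms permutes_compose by blast
      moreover have "insert s P \<subseteq> D" using assms by simp
      ultimately have "num_cycles D ((p \<circ> f) \<circ> (g \<circ> r)) + card D = num_cycles D (p \<circ> f) + num_cycles D (g \<circ> r)"
        by (intro num_cycles_comp_single_intersection[OF fin(2) assms(1) _ _ gr]) auto
      then show ?thesis by linarith
    qed
    finally show ?thesis .
  qed
  \<comment> \<open>\<open>sign p\<close> is its own inverse, so the summand can be written in terms
    of \<open>p \<circ> f\<close> and the sum over \<open>f\<close> shifted.\<close>
  have sgn: "sign f = sign p * sign (p \<circ> f)" if f: "f permutes A" for f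
  proof -
    have "permutation f" "permutation p"
      using f pA fin permutation_permutes by blast+
    then show ?thesis by (simp add: sign_compose)
  qed
  let ?K = "\<lambda>g. real (num_cycles D (g \<circ> r)) - real (card D)"
  have "signed_sum_cycles D t A = (\<Sum>f | f permutes A. \<Sum>g | g permutes D - A.
      sign p * sign (p \<circ> f) * (real (num_cycles D (p \<circ> f)) + ?K g))"
    unfolding signed_sum_cycles_def by (intro sum.cong refl) (simp add: cyc sgn[symmetric] flip: of_int_mult)
  also have "\<dots> = (\<Sum>f | f permutes A. \<Sum>g | g permutes D - A.
      sign p * sign f * (real (num_cycles D f) + ?K g))"
    by (rule setum_permutations_compose_left[OF pA, symmetric])
  \<comment> \<open>The part \<open>?K g\<close> multiplies the sum of the signs on
    \<open>A\<close>, which vanishes; hence only the number of permutations \<open>g\<close>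
    matters.\<close>
  also have "\<dots> = (\<Sum>g | g permutes D - A.
      sign p * (\<Sum>f | f permutes A. sign f * real (num_cycles D f)) + sign p * ?K g * (\<Sum>f | f permutes A. real_of_int (sign f)))"
    by (subst sum.swap) (simp add: sum_distrib_left sum.distrib sum_subtractf algebra_simps)
  also have "(\<Sum>f | f permutes A. real_of_int (sign f)) = 0"
    using sum_sign[OF fin(1) assms(7)] by (metis of_int_0 of_int_sum)
  also have "(\<Sum>f | f permutes A. sign f * real (num_cycles D f)) = (-1) ^ card A * fact (card A - 2)"
    using arg_cong[OF sum_sign_num_cycles[OF assms(1,6,7)], of real_of_int] by simp
  also have "(\<Sum>g | g permutes D - A. real_of_int (sign p) * ((-1) ^ card A * fact (card A - 2)) + sign p * ?K g * 0)
      = real (card {g. g permutes D - A}) * (real_of_int (sign p) * ((-1) ^ card A * fact (card A - 2)))"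
    by simp
  also have "card {g. g permutes D - A} = fact (card D - card A)"
    using assms fin by (subst card_permutations[of _ "card D - card A"]) (auto simp: card_Diff_subset)
  finally show ?thesis by (simp add: algebra_simps)
qed

text \<open>Averaging over the base point makes the sum over subsets symmetric.\<close>

lemma sum_num_cycles_cyclic_on:
  assumes "finite D"
  shows "real (card D) * (\<Sum>f | f permutes D \<and> cyclic_on f D. real (num_cycles D (f \<circ> t))) =
    - (\<Sum>A\<in>Pow D. (-1) ^ card A * real (card A) * signed_sum_cycles D t A)"
proof -
  let ?g = "\<lambda>A. (-1) ^ card A * signed_sum_cycles D t A"
  have "real (card D) * (\<Sum>f | f permutes D \<and> cyclic_on f D. real (num_cycles D (f \<circ> t))) =
     (\<Sum>x\<in>D. \<Sum>f | f permutes D \<and> cyclic_on f D. real (num_cycles D (f \<circ> t)))"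
    by simp
  also have "\<dots> = (\<Sum>x\<in>D. - (\<Sum>A | A \<subseteq> D \<and> x \<in> A. ?g A))"
    using assms by (intro sum.cong refl) (simp add: signed_sum_cycles_def sum_cyclic_on)
  also have "\<dots> = - (\<Sum>x\<in>D. \<Sum>A | A \<in> Pow D \<and> x \<in> A. ?g A)"
    by (simp add: sum_negf)
  \<comment> \<open>Each \<open>A\<close> is counted once for every base point in it.\<close>
  also have "(\<Sum>x\<in>D. \<Sum>A | A \<in> Pow D \<and> x \<in> A. ?g A) = (\<Sum>A\<in>Pow D. \<Sum>x | x \<in> D \<and> x \<in> A. ?g A)"
    using assms by (intro sum.swap_restrict) auto
  also have "\<dots> = (\<Sum>A\<in>Pow D. (-1) ^ card A * real (card A) * signed_sum_cycles D t A)"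
  proof (intro sum.cong refl)
    fix A assume "A \<in> Pow D"
    then have "{x. x \<in> D \<and> x \<in> A} = A" by auto
    then show "(\<Sum>x | x \<in> D \<and> x \<in> A. ?g A) = (-1) ^ card A * real (card A) * signed_sum_cycles D t A"
      by simp
  qed
  finally show ?thesis .
qed

subsection \<open>Products with the edge reversal\<close>

text \<open>Partial reversals serve to split the full reversal into that of a set of edges and that
  of the remaining ones.\<close>

definition flip_on :: "'i set \<Rightarrow> 'i \<times> bool \<Rightarrow> 'i \<times> bool" where
  "flip_on J = (\<lambda>(i, b). (i, if i \<in> J then \<not> b else b))"

lemma bouquet_rev_eq_flip_on: "bouquet_rev n = flip_on {..<n}"
  by (auto simp: bouquet_rev_def flip_on_def fun_eq_iff)

lemma flip_on_permutes: "flip_on J permutes J \<times> UNIV"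
  unfolding permutes_def
proof (intro conjI allI impI)
  fix y
  show "\<exists>!x. flip_on J x = y"
    by (rule ex1I[of _ "flip_on J y"]) (auto simp: flip_on_def split: prod.splits)
qed (auto simp: flip_on_def)

lemma flip_on_insert:
  "i \<notin> J \<Longrightarrow> flip_on (insert i J) = Transposition.transpose (i, False) (i, True) \<circ> flip_on J"
  by (auto simp: flip_on_def fun_eq_iff Transposition.transpose_def)

lemma flip_on_Un: "J \<inter> K = {} \<Longrightarrow> flip_on (J \<union> K) = flip_on J \<circ> flip_on K"
  by (auto simp: flip_on_def fun_eq_iff)

lemma flip_on_empty: "flip_on {} = id"
  by (simp add: flip_on_def fun_eq_iff)

lemma sign_flip_on: "finite J \<Longrightarrow> sign (flip_on J) = (-1) ^ card J"
proof (induction J rule: finite_induct)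
  case empty
  then show ?case by (simp add: flip_on_empty)
next
  case (insert i J)
  have "sign (flip_on (insert i J)) = - sign (flip_on J)"
    unfolding flip_on_insert[OF insert(2)]
    by (rule sign_transpose_comp[OF _ flip_on_permutes]) (use insert in auto)
  then show ?case using insert by simp
qed

text \<open>The reversal is a product of \<open>card J\<close> transpositions, each adding at most
  one cycle. For a full cycle \<open>f\<close> this bounds the number of faces, which makes the
  genus nonnegative.\<close>

lemma num_cycles_comp_flip_on:
  assumes "finite D" "f permutes D" "finite J" "J \<times> UNIV \<subseteq> D"
  shows "num_cycles D (f \<circ> flip_on J) \<le> num_cycles D f + card J"
proof -
  have flip: "flip_on K permutes D" if "K \<subseteq> J" for K
    by (rule permutes_subset[OF flip_on_permutes]) (use that assms in auto)
  have "num_cycles D (flip_on K \<circ> f) \<le> num_cycles D f + card K" if "finite K" "K \<subseteq> J" for K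
    using that
  proof (induction K rule: finite_induct)
    case empty
    then show ?case by (simp add: flip_on_empty)
  next
    case (insert i K)
    have "flip_on (insert i K) \<circ> f = Transposition.transpose (i, False) (i, True) \<circ> (flip_on K \<circ> f)"
      by (simp only: flip_on_insert[OF insert(2)] o_assoc)
    moreover have "(i, False) \<in> D" "(i, True) \<in> D" "flip_on K permutes D"
      using insert assms flip[of K] by auto
    ultimately have "num_cycles D (flip_on (insert i K) \<circ> f) \<le> num_cycles D (flip_on K \<circ> f) + 1"
      using num_cycles_comp_transpose_le[OF assms(1) permutes_compose[OF assms(2)]] by metis
    then show ?case using insert by (simp add: o_def)
  qed
  then show ?thesis
    using num_cycles_comp_commute[OF assms(1,2) flip[OF order_refl]] assms by auto
qed

text \<open>If at most one half-edge of \<open>A\<close> is flipped out of \<open>A\<close>, then \<open>A\<close> consists of full edges and at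
  most one single half-edge.\<close>

lemma sum_half_edge_subsets:
  fixes g :: "(nat \<times> bool) set \<Rightarrow> real"
  assumes "\<And>A a b. A \<subseteq> {..<n} \<times> UNIV \<Longrightarrow> a \<in> A \<Longrightarrow> b \<in> A \<Longrightarrow> a \<noteq> b \<Longrightarrow>
      flip_on {..<n} a \<notin> A \<Longrightarrow> flip_on {..<n} b \<notin> A \<Longrightarrow> g A = 0"
  shows "(\<Sum>A\<in>Pow ({..<n} \<times> UNIV). g A) = (\<Sum>J\<in>Pow {..<n}. g (J \<times> UNIV)) +
     (\<Sum>J\<in>Pow {..<n}. \<Sum>s\<in>({..<n} - J) \<times> UNIV. g (insert s (J \<times> UNIV)))"
proof -
  let ?D = "{..<n} \<times> (UNIV :: bool set)"
  let ?I = "SIGMA J : Pow {..<n}. ({..<n} - J) \<times> (UNIV :: bool set)"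
  let ?e = "\<lambda>J :: nat set. J \<times> (UNIV :: bool set)"
  let ?o = "\<lambda>(J :: nat set, s :: nat \<times> bool). insert s (J \<times> UNIV)"
  \<comment> \<open>The full edges inside the set recover \<open>J\<close>; this makes the
    parametrization injective.\<close>
  have rec: "fst x = {i. (i, False) \<in> ?o x \<and> (i, True) \<in> ?o x}"
    if "x \<in> ?I" for x
    using that by (cases x) auto
  have inj_o: "inj_on ?o ?I"
  proof (rule inj_onI)
    fix x y assume xy: "x \<in> ?I" "y \<in> ?I" "?o x = ?o y"
    have "fst x = {i. (i, False) \<in> ?o y \<and> (i, True) \<in> ?o y}"
      using rec[OF xy(1)] by (simp only: xy(3))
    also have "\<dots> = fst y" using rec[OF xy(2)] by (rule sym)
    finally obtain J s t where [simp]: "x = (J, s)" "y = (J, t)" by (cases x, cases y) auto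
    have "s \<in> insert t (J \<times> UNIV)" using xy(3) by auto
    then show "x = y" using xy(1) by auto
  qed
  have disj: "?e ` Pow {..<n} \<inter> ?o ` ?I = {}"
  proof (rule equals0I)
    fix A assume "A \<in> ?e ` Pow {..<n} \<inter> ?o ` ?I"
    then obtain K x where x: "A = K \<times> UNIV" "x \<in> ?I" "A = ?o x" by blast
    obtain J i b where "x = (J, (i, b))" by (metis surj_pair)
    then have *: "K \<times> UNIV = insert (i, b) (J \<times> UNIV)" "i \<notin> J" using x by auto
    \<comment> \<open>A union of full edges also contains the partner of the extra
      half-edge.\<close>
    then have "(i, \<not> b) \<in> K \<times> UNIV" by auto
    then show False unfolding *(1) using *(2) by auto
  qed
  have zero: "g A = 0" if A: "A \<in> Pow ?D" "A \<notin> ?e ` Pow {..<n} \<union> ?o ` ?I" for A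
  proof -
    \<comment> \<open>\<open>J\<close> collects the full edges of \<open>A\<close>. As
      \<open>A\<close> has neither of the two forms, it contains two further half-edges, both
      without their partners.\<close>
    define J where "J = {i. (i, False) \<in> A \<and> (i, True) \<in> A}"
    have J: "J \<subseteq> {..<n}" using A(1) unfolding J_def by auto
    have "(i, b) \<in> A" if "i \<in> J" for i b using that by (cases b) (auto simp: J_def)
    then have JA: "J \<times> UNIV \<subseteq> A" by auto
    have "?e J \<in> ?e ` Pow {..<n}" using J by (intro imageI PowI)
    then have "A \<noteq> J \<times> UNIV" using A(2) by (simp only: Un_iff) blast
    then obtain a where a: "a \<in> A" "a \<notin> J \<times> UNIV" using JA by blast
    have "(J, a) \<in> ?I" using a A(1) J by auto
    then have "?o (J, a) \<in> ?o ` ?I" by (rule imageI)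
    then have "A \<noteq> insert a (J \<times> UNIV)" using A(2) by (simp only: split Un_iff) blast
    then obtain b where b: "b \<in> A" "b \<notin> J \<times> UNIV" "a \<noteq> b" using JA a by blast
    have "flip_on {..<n} x \<notin> A" if "x \<in> A" "x \<notin> J \<times> UNIV" for x
    proof -
      obtain i c where x: "x = (i, c)" by (cases x)
      then have "i < n" using that A(1) by auto
      then show ?thesis using that x by (cases c) (auto simp: flip_on_def J_def)
    qed
    then show ?thesis using assms[of A a b] A(1) a b by auto
  qed
  have "(\<Sum>A\<in>Pow ?D. g A) = (\<Sum>A\<in>?e ` Pow {..<n} \<union> ?o ` ?I. g A)"
    using zero by (intro sum.mono_neutral_right) auto
  also have "\<dots> = (\<Sum>A\<in>?e ` Pow {..<n}. g A) + (\<Sum>A\<in>?o ` ?I. g A)"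
    using disj by (intro sum.union_disjoint) auto
  also have "(\<Sum>A\<in>?e ` Pow {..<n}. g A) = (\<Sum>J\<in>Pow {..<n}. g (J \<times> UNIV))"
    by (subst sum.reindex) (auto simp: inj_on_def)
  also have "(\<Sum>A\<in>?o ` ?I. g A) = (\<Sum>J\<in>Pow {..<n}. \<Sum>s\<in>({..<n} - J) \<times> UNIV. g (insert s (J \<times> UNIV)))"
    by (subst sum.reindex[OF inj_o], subst sum.Sigma) (auto intro!: sum.cong)
  finally show ?thesis .
qed

section \<open>The total number of faces over all full cycles\<close>

lemma sum_Pow_card:
  fixes h :: "nat \<Rightarrow> real"
  assumes "finite S"
  shows "(\<Sum>J\<in>Pow S. h (card J)) = (\<Sum>j\<le>card S. real (card S choose j) * h j)"
proof -
  have "(\<Sum>J\<in>Pow S. h (card J)) = (\<Sum>j\<le>card S. \<Sum>J | J \<in> Pow S \<and> card J = j. h (card J))"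
    using assms by (intro sum.group[symmetric]) (auto intro: card_mono)
  also have "\<dots> = (\<Sum>j\<le>card S. real (card S choose j) * h j)"
    using assms by (intro sum.cong refl) (simp add: n_subsets)
  finally show ?thesis .
qed

text \<open>For \<open>j <= n\<close> this is the normalized trace of a fixed-point-free involution
  of \<open>2 * n\<close> points on the exterior power of degree \<open>2 * j\<close> of the
  permutation representation.\<close>

definition hook_coeff :: "nat \<Rightarrow> nat \<Rightarrow> real" where
  "hook_coeff n j = (-1) ^ j * real (n choose j) / real ((2 * n) choose (2 * j))"

lemma hook_coeff_fact:
  assumes "j \<le> n"
  shows "hook_coeff n j = (-1) ^ j * real (n choose j) * fact (2 * j) * fact (2 * n - 2 * j) / fact (2 * n)"
  using assms by (simp add: hook_coeff_def binomial_fact)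

text \<open>A single half-edge yields the harmonic number. A set of \<open>j >= 1\<close> full edges
  yields the part with \<open>2 * j - 1\<close>, and adding one of the \<open>2 * (n - j)\<close>
  remaining half-edges yields the other part.\<close>

lemma expected_num_cycles:
  assumes "n \<ge> 1"
  defines "D \<equiv> {..<n} \<times> (UNIV :: bool set)"
  shows "(\<Sum>f | f permutes D \<and> cyclic_on f D. real (num_cycles D (f \<circ> flip_on {..<n}))) =
    fact (2 * n - 1) * (harm (2 * n - 1) -
     (\<Sum>j = 1..n. hook_coeff n j * (1 / (2 * real j - 1) + (if j < n then 1 + 1 / (2 * real j) else 0))))"
proof -
  let ?t = "flip_on {..<n}"
  let ?g = "\<lambda>A. (-1) ^ card A * real (card A) * signed_sum_cycles D ?t A"
  let ?T = "\<Sum>f | f permutes D \<and> cyclic_on f D. real (num_cycles D (f \<circ> ?t))"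
  have fin: "finite D" by (simp add: D_def)
  have cardD: "card D = 2 * n" by (simp add: D_def card_cartesian_product)
  have t: "?t permutes D" unfolding D_def by (rule flip_on_permutes)
  \<comment> \<open>The reversal of \<open>J\<close> acts inside the set and that of the other edges
    outside \<open>J \<times> UNIV\<close>; \<open>s\<close> is the only point that both may
    move.\<close>
  have inv: "signed_sum_cycles D ?t (insert s (J \<times> UNIV)) =
      (-1) ^ card J * (-1) ^ m * fact (m - 2) * fact (2 * n - m)"
    if J: "J \<subseteq> {..<n}" and s: "s \<in> D" and m: "m = card (insert s (J \<times> UNIV))" "2 \<le> m" for J s m
  proof -
    have finJ: "finite J" using J finite_subset by auto
    have "D - J \<times> UNIV = ({..<n} - J) \<times> UNIV" by (auto simp: D_def)
    then have 1: "flip_on ({..<n} - J) permutes D - J \<times> UNIV"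
      by (simp only: flip_on_permutes)
    have 2: "?t = flip_on ({..<n} - J) \<circ> flip_on J"
      using J by (subst flip_on_Un[symmetric]) (auto simp: Un_absorb2)
    have 3: "insert s (J \<times> UNIV) \<subseteq> D" using J s by (auto simp: D_def)
    show ?thesis
      unfolding signed_sum_cycles_invariant[OF fin flip_on_permutes 1 2 refl 3 m(2)[unfolded m(1)]]
      by (simp only: m(1)[symmetric] cardD sign_flip_on[OF finJ]) simp
  qed
  have even: "?g (J \<times> UNIV) = (if card J = 0 then 0 else
      (-1) ^ card J * (2 * real (card J) * fact (2 * card J - 2) * fact (2 * n - 2 * card J)))"
    if J: "J \<subseteq> {..<n}" for J
  proof (cases "J = {}")
    case True
    then show ?thesis by simp
  next
    case False
    then obtain i where i: "i \<in> J" by auto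
    have "finite J" using J finite_subset by auto
    then have J0: "card J > 0" using i by (auto simp: card_gt_0_iff)
    \<comment> \<open>Choosing \<open>s\<close> inside \<open>J \<times> UNIV\<close> covers the
      case without an extra half-edge.\<close>
    have "insert (i, False) (J \<times> UNIV) = J \<times> UNIV" using i by auto
    moreover have "card (J \<times> (UNIV :: bool set)) = 2 * card J" by (simp add: card_cartesian_product)
    moreover have "(i, False) \<in> D" using i J by (auto simp: D_def)
    ultimately show ?thesis
      using inv[OF J, of "(i, False)" "2 * card J"] J0 by simp
  qed
  \<comment> \<open>For empty \<open>J\<close> the set is a singleton, which is evaluated separately
    and gives the harmonic number.\<close>
  have odd: "?g (insert s (J \<times> UNIV)) = (if card J = 0 then - (fact (2 * n - 1) * harm (2 * n - 1)) else
      (-1) ^ card J * ((2 * real (card J) + 1) * fact (2 * card J - 1) * fact (2 * n - 2 * card J - 1)))"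
    if J: "J \<subseteq> {..<n}" and s: "s \<in> ({..<n} - J) \<times> UNIV" for J s
  proof -
    have finJ: "finite J" using J finite_subset by auto
    have sD: "s \<in> D" using s by (auto simp: D_def)
    have "s \<notin> J \<times> UNIV" using s by auto
    then have c: "card (insert s (J \<times> (UNIV :: bool set))) = 2 * card J + 1"
      using finJ by (simp add: card_cartesian_product)
    show ?thesis
    proof (cases "card J = 0")
      case True
      then have "J = {}" using finJ by simp
      moreover have "?t s \<noteq> s" using sD by (auto simp: D_def flip_on_def)
      ultimately show ?thesis using signed_sum_cycles_singleton[OF fin t sD] by (simp add: cardD)
    next
      case False
      then show ?thesis
        using inv[OF J sD c[symmetric]] by (simp add: c algebra_simps)
    qed
  qed
  have "2 * real n * ?T = - (\<Sum>A\<in>Pow D. ?g A)"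
    using sum_num_cycles_cyclic_on[OF fin, of ?t] by (simp add: cardD)
  also have "(\<Sum>A\<in>Pow D. ?g A) = (\<Sum>J\<in>Pow {..<n}. ?g (J \<times> UNIV)) +
      (\<Sum>J\<in>Pow {..<n}. \<Sum>s\<in>({..<n} - J) \<times> UNIV. ?g (insert s (J \<times> UNIV)))"
    unfolding D_def
    by (rule sum_half_edge_subsets) (simp add: signed_sum_cycles_eq_0[OF fin t, unfolded D_def])
  also have "(\<Sum>J\<in>Pow {..<n}. ?g (J \<times> UNIV)) = (\<Sum>J\<in>Pow {..<n}. if card J = 0 then 0 else
      (-1) ^ card J * (2 * real (card J) * fact (2 * card J - 2) * fact (2 * n - 2 * card J)))"
    by (intro sum.cong refl even) auto
  also have "(\<Sum>J\<in>Pow {..<n}. \<Sum>s\<in>({..<n} - J) \<times> UNIV. ?g (insert s (J \<times> UNIV))) =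
     (\<Sum>J\<in>Pow {..<n}. 2 * real (n - card J) * (if card J = 0 then - (fact (2 * n - 1) * harm (2 * n - 1)) else
      (-1) ^ card J * ((2 * real (card J) + 1) * fact (2 * card J - 1) * fact (2 * n - 2 * card J - 1))))"
  proof (intro sum.cong refl)
    fix J assume "J \<in> Pow {..<n}"
    then have J: "J \<subseteq> {..<n}" by simp
    then have "card (({..<n} - J) \<times> (UNIV :: bool set)) = 2 * (n - card J)"
      using finite_subset[OF J] by (simp add: card_cartesian_product card_Diff_subset)
    then show "(\<Sum>s\<in>({..<n} - J) \<times> UNIV. ?g (insert s (J \<times> UNIV))) = 2 * real (n - card J) *
      (if card J = 0 then - (fact (2 * n - 1) * harm (2 * n - 1)) else
      (-1) ^ card J * ((2 * real (card J) + 1) * fact (2 * card J - 1) * fact (2 * n - 2 * card J - 1)))"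
      using odd[OF J] by (simp only: sum_constant cong: sum.cong)
  qed
  also have "(\<Sum>J\<in>Pow {..<n}. if card J = 0 then 0 else
      (-1) ^ card J * (2 * real (card J) * fact (2 * card J - 2) * fact (2 * n - 2 * card J))) =
      (\<Sum>j\<le>n. real (n choose j) * (if j = 0 then 0 else (-1) ^ j * (2 * real j * fact (2 * j - 2) * fact (2 * n - 2 * j))))"
    using sum_Pow_card[of "{..<n}" "\<lambda>j. if j = 0 then 0 else
        (-1) ^ j * (2 * real j * fact (2 * j - 2) * fact (2 * n - 2 * j))"] by simp
  also have "(\<Sum>J\<in>Pow {..<n}. 2 * real (n - card J) * (if card J = 0 then - (fact (2 * n - 1) * harm (2 * n - 1)) else
      (-1) ^ card J * ((2 * real (card J) + 1) * fact (2 * card J - 1) * fact (2 * n - 2 * card J - 1)))) =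
      (\<Sum>j\<le>n. real (n choose j) * (2 * real (n - j) * (if j = 0 then - (fact (2 * n - 1) * harm (2 * n - 1)) else
      (-1) ^ j * ((2 * real j + 1) * fact (2 * j - 1) * fact (2 * n - 2 * j - 1)))))"
    using sum_Pow_card[of "{..<n}" "\<lambda>j. 2 * real (n - j) * (if j = 0 then - (fact (2 * n - 1) * harm (2 * n - 1)) else
      (-1) ^ j * ((2 * real j + 1) * fact (2 * j - 1) * fact (2 * n - 2 * j - 1)))"] by simp
  \<comment> \<open>The term \<open>j = 0\<close> is split off: the empty set has weight zero, and
    the \<open>2 * n\<close> singletons give the harmonic part.\<close>
  also have "{..n} = insert 0 {1..n}" by auto
  also have "- ((\<Sum>j\<in>insert 0 {1..n}. real (n choose j) * (if j = 0 then 0 else (-1) ^ j * (2 * real j * fact (2 * j - 2) * fact (2 * n - 2 * j)))) +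
     (\<Sum>j\<in>insert 0 {1..n}. real (n choose j) * (2 * real (n - j) * (if j = 0 then - (fact (2 * n - 1) * harm (2 * n - 1)) else
      (-1) ^ j * ((2 * real j + 1) * fact (2 * j - 1) * fact (2 * n - 2 * j - 1)))))) =
     2 * real n * fact (2 * n - 1) * harm (2 * n - 1) -
     (\<Sum>j = 1..n. real (n choose j) * ((-1) ^ j * (2 * real j * fact (2 * j - 2) * fact (2 * n - 2 * j))) +
      real (n choose j) * (2 * real (n - j) * ((-1) ^ j * ((2 * real j + 1) * fact (2 * j - 1) * fact (2 * n - 2 * j - 1)))))"
    by (simp add: sum.distrib)
  also have "(\<Sum>j = 1..n. real (n choose j) * ((-1) ^ j * (2 * real j * fact (2 * j - 2) * fact (2 * n - 2 * j))) +
      real (n choose j) * (2 * real (n - j) * ((-1) ^ j * ((2 * real j + 1) * fact (2 * j - 1) * fact (2 * n - 2 * j - 1))))) =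
     (\<Sum>j = 1..n. fact (2 * n) * (hook_coeff n j * (1 / (2 * real j - 1) + (if j < n then 1 + 1 / (2 * real j) else 0))))"
  proof (intro sum.cong refl)
    fix j assume "j \<in> {1..n}"
    then have j: "j \<ge> 1" "j \<le> n" by auto
    define c where "c = (-1) ^ j * real (n choose j)"
    have f1: "2 * real j * fact (2 * j - 2) = fact (2 * j) / (2 * real j - 1)"
    proof -
      obtain k where "j = Suc k" using j by (cases j) auto
      then show ?thesis by (simp add: field_simps)
    qed
    have f2: "(2 * real j + 1) * fact (2 * j - 1) = fact (2 * j) * (1 + 1 / (2 * real j))"
    proof -
      obtain k where "j = Suc k" using j by (cases j) auto
      then show ?thesis by (simp add: field_simps)
    qed
    \<comment> \<open>For \<open>j = n\<close> no half-edge is left to add, and both sides are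
      zero.\<close>
    have f3: "2 * real (n - j) * fact (2 * n - 2 * j - 1) = (if j < n then fact (2 * n - 2 * j) else 0)"
    proof (cases "j < n")
      case True
      then obtain k where "n = Suc (j + k)" using less_iff_Suc_add by auto
      then show ?thesis by (simp add: field_simps)
    qed (use j in auto)
    have "real (n choose j) * ((-1) ^ j * (2 * real j * fact (2 * j - 2) * fact (2 * n - 2 * j))) +
      real (n choose j) * (2 * real (n - j) * ((-1) ^ j * ((2 * real j + 1) * fact (2 * j - 1) * fact (2 * n - 2 * j - 1)))) =
      c * ((2 * real j * fact (2 * j - 2)) * fact (2 * n - 2 * j) +
        ((2 * real j + 1) * fact (2 * j - 1)) * (2 * real (n - j) * fact (2 * n - 2 * j - 1)))"
      by (simp add: c_def algebra_simps)
    also have "\<dots> = c * fact (2 * j) * fact (2 * n - 2 * j) * (1 / (2 * real j - 1) + (if j < n then 1 + 1 / (2 * real j) else 0))"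
      unfolding f1 f2 f3 by (simp add: algebra_simps)
    also have "c * fact (2 * j) * fact (2 * n - 2 * j) = fact (2 * n) * hook_coeff n j"
      using j by (simp add: hook_coeff_fact c_def)
    finally show "real (n choose j) * ((-1) ^ j * (2 * real j * fact (2 * j - 2) * fact (2 * n - 2 * j))) +
      real (n choose j) * (2 * real (n - j) * ((-1) ^ j * ((2 * real j + 1) * fact (2 * j - 1) * fact (2 * n - 2 * j - 1)))) =
      fact (2 * n) * (hook_coeff n j * (1 / (2 * real j - 1) + (if j < n then 1 + 1 / (2 * real j) else 0)))"
      by (simp only: mult.assoc)
  qed
  also have "fact (2 * n) = 2 * real n * fact (2 * n - 1)"
    using assms(1) by (subst fact_reduce) auto
  finally have "2 * real n * ?T = 2 * real n * (fact (2 * n - 1) * (harm (2 * n - 1) -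
     (\<Sum>j = 1..n. hook_coeff n j * (1 / (2 * real j - 1) + (if j < n then 1 + 1 / (2 * real j) else 0)))))"
    by (simp only: sum_distrib_left[symmetric] right_diff_distrib mult.assoc)
  then show ?thesis using assms(1) by (simp only: mult_cancel_left) simp
qed

subsection \<open>The alternating sum\<close>

lemma hook_coeff_Suc:
  assumes "j \<le> m"
  shows "(2 * real m + 1) * hook_coeff (Suc m) j = (2 * real m + 1 - 2 * real j) * hook_coeff m j"
    and "(2 * real m + 1 - 2 * real j) * hook_coeff (Suc m) (Suc j) = - (2 * real j + 1) * hook_coeff (Suc m) j"
proof -
  \<comment> \<open>\<open>hook_coeff n j\<close> is \<open>(-1) ^ j\<close> times the ratio of \<open>u j * u (n - j)\<close> and \<open>u n\<close>.\<close>
  define u where "u k = (fact (2 * k) / fact k :: real)" for k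
  have u_Suc: "u (Suc k) = 2 * (2 * real k + 1) * u k" for k
  proof -
    have "fact (2 * Suc k) = (real k + 1) * (2 * (2 * real k + 1) * fact (2 * k))"
      by (simp add: algebra_simps)
    moreover have "fact (Suc k) = (real k + 1) * fact k" by (simp add: algebra_simps)
    moreover have "real k + 1 \<noteq> 0" by linarith
    ultimately show ?thesis
      unfolding u_def by (metis mult_divide_mult_cancel_left times_divide_eq_right)
  qed
  have u_pos: "u k > 0" for k by (simp add: u_def)
  have hook: "hook_coeff (i + d) i = (-1) ^ i * (u i * u d / u (i + d))" for i d
    by (simp add: hook_coeff_fact binomial_fact u_def)
  obtain d where m: "m = j + d" using assms le_iff_add by blast
  have 1: "hook_coeff (Suc m) j = (-1) ^ j * (u j * u (Suc d) / u (Suc m))"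
    using hook[of j "Suc d"] by (simp add: m)
  have 2: "hook_coeff m j = (-1) ^ j * (u j * u d / u m)"
    using hook[of j d] by (simp add: m)
  have 3: "hook_coeff (Suc m) (Suc j) = - ((-1) ^ j * (u (Suc j) * u d / u (Suc m)))"
    using hook[of "Suc j" d] by (simp add: m)
  have d: "2 * real m + 1 - 2 * real j = 2 * real d + 1" by (simp add: m)
  have m0: "2 * real m + 1 \<noteq> 0" "u m \<noteq> 0" using u_pos[of m] by linarith+
  show "(2 * real m + 1) * hook_coeff (Suc m) j = (2 * real m + 1 - 2 * real j) * hook_coeff m j"
    unfolding 1 2 d u_Suc using m0 by (simp add: divide_simps) (simp add: algebra_simps)
  show "(2 * real m + 1 - 2 * real j) * hook_coeff (Suc m) (Suc j) = - (2 * real j + 1) * hook_coeff (Suc m) j"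
    unfolding 1 3 d u_Suc divide_inverse by (simp add: algebra_simps)
qed

lemma hook_coeff_0 [simp]: "hook_coeff n 0 = 1" and hook_coeff_self [simp]: "hook_coeff n n = (-1) ^ n"
  by (simp_all add: hook_coeff_def)

lemma sum_hook_coeff:
  "(\<Sum>j\<le>n. hook_coeff n j) = (1 + (-1) ^ n) * (2 * real n + 1) / (2 * real n + 2)"
proof -
  \<comment> \<open>The recurrence in \<open>j\<close> turns \<open>T (Suc j)\<close> into
    \<open>- (2 * j + 1)\<close> times \<open>hook_coeff n j\<close>, so
    \<open>T j - T (Suc j)\<close> is \<open>2 * n + 2\<close> times the summand.\<close>
  define T where "T j = (2 * real n + 1 - 2 * real j) * hook_coeff n j" for j
  have "(2 * real n + 2) * hook_coeff n j = T j - T (Suc j)" if j: "j < n" for j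
  proof -
    obtain m where m: "n = Suc m" using j by (cases n) auto
    have "T (Suc j) = (2 * real m + 1 - 2 * real j) * hook_coeff (Suc m) (Suc j)"
      by (simp add: T_def m)
    also have "\<dots> = - (2 * real j + 1) * hook_coeff n j"
      using j m by (subst hook_coeff_Suc) auto
    finally show ?thesis by (simp add: T_def algebra_simps)
  qed
  then have "(2 * real n + 2) * (\<Sum>j<n. hook_coeff n j) = (\<Sum>j<n. T j - T (Suc j))"
    by (simp add: sum_distrib_left)
  also have "\<dots> = T 0 - T n" by (rule sum_lessThan_telescope')
  also have "\<dots> = 2 * real n + 1 - (-1) ^ n" by (simp add: T_def)
  \<comment> \<open>The summand \<open>j = n\<close> is not covered by the telescoping identity and
    is added here.\<close>
  finally have "(2 * real n + 2) * (\<Sum>j\<le>n. hook_coeff n j) = (1 + (-1) ^ n) * (2 * real n + 1)"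
    by (simp add: lessThan_Suc_atMost[symmetric] algebra_simps)
  then show ?thesis by (simp add: field_simps)
qed

lemma sum_hook_coeff_from_1:
  "(\<Sum>j = 1..n. hook_coeff n j) = (1 + (-1) ^ n) * (2 * real n + 1) / (2 * real n + 2) - 1"
proof -
  have "{..n} = insert 0 {1..n}" by auto
  then have "(\<Sum>j\<le>n. hook_coeff n j) = 1 + (\<Sum>j = 1..n. hook_coeff n j)" by simp
  then show ?thesis by (simp add: sum_hook_coeff)
qed

text \<open>The recurrence in \<open>n\<close> multiplies \<open>hook_coeff m j\<close> by
  \<open>1 - 2 * j / (2 * m + 1)\<close>, and division by \<open>2 * j\<close> cancels in the second
  part. The last term is the summand \<open>j = Suc m\<close>.\<close>

lemma sum_hook_coeff_over_even:
  "(\<Sum>j = 1..Suc m. hook_coeff (Suc m) j / (2 * real j)) =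
   (\<Sum>j = 1..m. hook_coeff m j / (2 * real j)) - (\<Sum>j = 1..m. hook_coeff m j) / (2 * real m + 1)
     - (-1) ^ m / (2 * real m + 2)"
proof -
  have "hook_coeff (Suc m) j / (2 * real j) = hook_coeff m j / (2 * real j) - hook_coeff m j / (2 * real m + 1)"
    if "j \<in> {1..m}" for j
  proof -
    have "2 * real m + 1 \<noteq> 0" by linarith
    then have "hook_coeff (Suc m) j = (2 * real m + 1 - 2 * real j) * hook_coeff m j / (2 * real m + 1)"
      using hook_coeff_Suc(1)[of j m] that by (simp add: field_simps)
    then show ?thesis using that \<open>2 * real m + 1 \<noteq> 0\<close> by (simp add: divide_simps) (simp add: algebra_simps)
  qed
  then have "(\<Sum>j = 1..m. hook_coeff (Suc m) j / (2 * real j)) =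
      (\<Sum>j = 1..m. hook_coeff m j / (2 * real j)) - (\<Sum>j = 1..m. hook_coeff m j) / (2 * real m + 1)"
    by (simp add: sum_subtractf sum_divide_distrib)
  then show ?thesis by simp
qed

text \<open>Splitting the recurrence factor as \<open>2 * m - (2 * j - 1)\<close> cancels the odd
  denominator in one part and leaves the induction hypothesis in the other.\<close>

lemma sum_hook_coeff_over_odd:
  "(\<Sum>j = 1..n. hook_coeff n j / (2 * real j - 1)) = - (1 - (-1) ^ n) / (2 * real n)"
proof (induction n)
  case 0
  then show ?case by simp
next
  case (Suc m)
  have m: "2 * real m + 1 \<noteq> 0" by linarith
  have "hook_coeff (Suc m) j / (2 * real j - 1) =
      (2 * real m * (hook_coeff m j / (2 * real j - 1)) - hook_coeff m j) / (2 * real m + 1)"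
    if "j \<in> {1..m}" for j
  proof -
    have "hook_coeff (Suc m) j = (2 * real m + 1 - 2 * real j) * hook_coeff m j / (2 * real m + 1)"
      using hook_coeff_Suc(1)[of j m] that m by (simp add: field_simps)
    moreover have "2 * real j - 1 \<noteq> 0" using that by auto
    ultimately show ?thesis using m by (simp add: divide_simps) (simp add: algebra_simps)
  qed
  then have "(\<Sum>j = 1..m. hook_coeff (Suc m) j / (2 * real j - 1)) =
      (2 * real m * (\<Sum>j = 1..m. hook_coeff m j / (2 * real j - 1)) - (\<Sum>j = 1..m. hook_coeff m j)) / (2 * real m + 1)"
    by (simp add: sum_subtractf sum_divide_distrib[symmetric] sum_distrib_left)
  also have "\<dots> = (2 * real m * (- (1 - (-1) ^ m) / (2 * real m)) -
      ((1 + (-1) ^ m) * (2 * real m + 1) / (2 * real m + 2) - 1)) / (2 * real m + 1)"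
    unfolding Suc.IH sum_hook_coeff_from_1 ..
  finally have *: "(\<Sum>j = 1..Suc m. hook_coeff (Suc m) j / (2 * real j - 1)) =
      (2 * real m * (- (1 - (-1) ^ m) / (2 * real m)) -
      ((1 + (-1) ^ m) * (2 * real m + 1) / (2 * real m + 2) - 1)) / (2 * real m + 1) - (-1) ^ m / (2 * real m + 1)"
    by (simp add: add_ac)
  \<comment> \<open>Parity fixes the power of -1, and \<open>m = 0\<close> is separate because
    \<open>2 * m\<close> cannot be cancelled there.\<close>
  show ?case unfolding * using m
    by (cases "even m"; cases "m = 0") (simp_all add: divide_simps, simp_all add: algebra_simps)
qed

text \<open>Two of the sums over \<open>j\<close> have closed forms; the one over
  \<open>1 / (2 * j)\<close> is known only through its recurrence in \<open>n\<close>. Both sides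
  are therefore compared by their increments in \<open>n\<close>.\<close>

lemma harm_minus_sum_hook_coeff:
  assumes "n \<ge> 1"
  shows "harm (2 * n - 1) -
     (\<Sum>j = 1..n. hook_coeff n j * (1 / (2 * real j - 1) + (if j < n then 1 + 1 / (2 * real j) else 0))) =
     (\<Sum>m<n. (1 + (-1) ^ m) / (real m + 1)) + (1 + (-1) ^ n) / (2 * (real n + 1))"
proof -
  let ?U = "\<lambda>n. (1 + (-1) ^ n) * (2 * real n + 1) / (2 * real n + 2) - 1"
  let ?V = "\<lambda>n. \<Sum>j = 1..n. hook_coeff n j / (2 * real j)"
  let ?W = "\<lambda>n. - (1 - (-1) ^ n) / (2 * real n)"
  let ?G = "\<lambda>n. harm (2 * n - 1) - ?W n - ?U n - ?V n + (-1) ^ n * (1 + 1 / (2 * real n))"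
  \<comment> \<open>The case distinction goes away when the second part is extended to
    \<open>j = n\<close> and that term is subtracted again.\<close>
  have "(\<Sum>j = 1..n. hook_coeff n j * (1 / (2 * real j - 1) + (if j < n then 1 + 1 / (2 * real j) else 0))) =
    (\<Sum>j = 1..n. hook_coeff n j / (2 * real j - 1) + hook_coeff n j + hook_coeff n j / (2 * real j)
      - (if j = n then (-1) ^ n * (1 + 1 / (2 * real n)) else 0))"
    by (intro sum.cong refl) (auto simp: algebra_simps)
  also have "\<dots> = ?W n + ?U n + ?V n - (-1) ^ n * (1 + 1 / (2 * real n))"
    using assms unfolding sum.distrib sum_subtractf sum_hook_coeff_over_odd sum_hook_coeff_from_1
    by simp
  also have "harm (2 * n - 1) - \<dots> = ?G n" by simp
  also have "?G n = (\<Sum>m<n. (1 + (-1) ^ m) / (real m + 1)) + (1 + (-1) ^ n) / (2 * (real n + 1))"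
    using assms
  proof (induction n rule: nat_induct_at_least)
    case base
    show ?case by (simp add: harm_expand)
  next
    case (Suc n)
    have h: "harm (2 * Suc n - 1) = harm (2 * n - 1) + 1 / (2 * real n) + 1 / (2 * real n + 1)"
    proof -
      have "2 * Suc n - 1 = Suc (Suc (2 * n - 1))" using Suc.hyps by simp
      moreover have "real (2 * n - 1) = 2 * real n - 1" using Suc.hyps by (simp add: of_nat_diff)
      ultimately show ?thesis by (simp only: harm_Suc of_nat_Suc) (simp add: inverse_eq_divide add_ac)
    qed
    \<comment> \<open>With names for the reciprocals and the sign, the increment becomes a
      polynomial identity.\<close>
    define a b c d e where "a = 1 / real n" and "b = 1 / (real n + 1)" and "c = 1 / (real n + 2)"
      and "d = 1 / (2 * real n + 1)" and "e = (-1 :: real) ^ n"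
    note defs = a_def b_def c_def d_def e_def
    have nz: "real n + 1 \<noteq> 0" "real n + 2 \<noteq> 0" "2 * real n + 1 \<noteq> 0" by linarith+
    have W: "?W n = - (1 - e) * a / 2" and WS: "?W (Suc n) = - (1 + e) * b / 2"
      by (simp_all add: defs add.commute)
    have U: "?U n = (1 + e) * (1 - b / 2) - 1" and US: "?U (Suc n) = (1 - e) * (1 - c / 2) - 1"
      using nz by (simp_all add: defs field_simps)
    have Ud: "((1 + e) * (1 - b / 2) - 1) / (2 * real n + 1) = (1 + e) * b / 2 - d"
    proof -
      have "1 - b / 2 = (2 * real n + 1) * (b / 2)" using nz by (simp add: b_def field_simps)
      then have "(1 + e) * (1 - b / 2) / (2 * real n + 1) = (1 + e) * (b / 2)"
        using nonzero_mult_div_cancel_left[OF nz(3), of "(1 + e) * (b / 2)"]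
        by (simp only: mult.left_commute)
      then show ?thesis by (simp add: d_def diff_divide_distrib)
    qed
    have V: "?V (Suc n) = ?V n - ((1 + e) * b / 2 - d) - e * b / 2"
    proof -
      have "(-1) ^ n / (2 * real n + 2) = e * b / 2" using nz by (simp add: defs field_simps)
      then show ?thesis unfolding sum_hook_coeff_over_even sum_hook_coeff_from_1 U Ud by simp
    qed
    have h': "harm (2 * Suc n - 1) = harm (2 * n - 1) + a / 2 + d"
      unfolding h by (simp add: defs)
    have X: "(-1) ^ n * (1 + 1 / (2 * real n)) = e * (1 + a / 2)"
        "(-1) ^ Suc n * (1 + 1 / (2 * real (Suc n))) = - e * (1 + b / 2)"
      by (simp_all add: defs add.commute)
    \<comment> \<open>All terms with \<open>a\<close> or \<open>d\<close> cancel: the odd reciprocal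
      added to the harmonic number is removed by the recurrence for \<open>?V\<close>.\<close>
    have "?G (Suc n) - ?G n = (1 + e) * b + (1 - e) * c / 2 - (1 + e) * b / 2"
      unfolding h' V W WS U US X by (simp add: field_simps)
    also have "\<dots> = (1 + (-1) ^ n) / (real n + 1) + (1 + (-1) ^ Suc n) / (2 * (real (Suc n) + 1)) -
        (1 + (-1) ^ n) / (2 * (real n + 1))"
      by (simp add: defs algebra_simps)
    finally have "?G (Suc n) - ?G n = (1 + (-1) ^ n) / (real n + 1) +
        (1 + (-1) ^ Suc n) / (2 * (real (Suc n) + 1)) - (1 + (-1) ^ n) / (2 * (real n + 1))" .
    then show ?case using Suc.IH unfolding sum.lessThan_Suc by linarith
  qed
  finally show ?thesis .
qed

subsection \<open>Average genus of the bouquet\<close>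

lemma rotation_systems_bouquet:
  assumes "n \<ge> 1"
  shows "rotation_systems (bouquet n) = {f. f permutes {..<n} \<times> UNIV \<and> cyclic_on f ({..<n} \<times> UNIV)}"
proof -
  have "out_arcs (bouquet n) () = {..<n} \<times> UNIV" "verts (bouquet n) = {()}" "arcs (bouquet n) = {..<n} \<times> UNIV"
    by (auto simp: out_arcs_def bouquet_def)
  moreover have "(0, False) \<in> {..<n} \<times> UNIV" using assms by simp
  then have "{..<n} \<times> (UNIV :: bool set) \<noteq> {}" by blast
  ultimately show ?thesis by (simp add: rotation_systems_def)
qed

text \<open>Euler's formula with one vertex and \<open>n\<close> edges; the correction for isolated
  vertices vanishes as \<open>n >= 1\<close>.\<close>

lemma has_genus_bouquet_iff:
  assumes "n \<ge> 1"
  shows "has_genus (bouquet n) (bouquet_rev n) f k \<longleftrightarrow>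
    num_cycles ({..<n} \<times> UNIV) (f \<circ> flip_on {..<n}) + 2 * k = n + 1"
proof -
  have "out_arcs (bouquet n) () = {..<n} \<times> UNIV" "verts (bouquet n) = {()}" "arcs (bouquet n) = {..<n} \<times> UNIV"
    by (auto simp: out_arcs_def bouquet_def)
  moreover have "(0, False) \<in> {..<n} \<times> UNIV" using assms by simp
  then have "{..<n} \<times> (UNIV :: bool set) \<noteq> {}" by blast
  ultimately show ?thesis
    using card_edges_bouquet[of n]
    unfolding has_genus_def num_faces_def face_boundaries_def num_cycles_def bouquet_rev_eq_flip_on
    by auto
qed

text \<open>\<open>n + 1 - ?F\<close> has to be nonnegative and even. The bound holds since
  \<open>n\<close> transpositions are applied to a single cycle; the parity follows from the signs
  of the full cycle, the reversal and their product.\<close>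

lemma ex_genus_bouquet:
  assumes "n \<ge> 1" "f \<in> rotation_systems (bouquet n)"
  shows "\<exists>k. has_genus (bouquet n) (bouquet_rev n) f k"
proof -
  let ?D = "{..<n} \<times> (UNIV :: bool set)"
  let ?F = "num_cycles ?D (f \<circ> flip_on {..<n})"
  have f: "f permutes ?D" "cyclic_on f ?D"
    using assms by (auto simp: rotation_systems_bouquet)
  have t: "flip_on {..<n} permutes ?D" by (rule flip_on_permutes)
  have "orbit f ` ?D = {?D}"
    using f(2) assms(1) by (auto simp: cyclic_on_alldef)
  then have 1: "num_cycles ?D f = 1" by (simp add: num_cycles_def)
  have le: "?F \<le> n + 1"
    using num_cycles_comp_flip_on[of ?D f "{..<n}"] f 1 by simp
  have "permutation f" by (rule permutes_imp_permutation[OF _ f(1)]) simp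
  moreover have "permutation (flip_on {..<n})" by (rule permutes_imp_permutation[OF _ t]) simp
  ultimately have "sign (f \<circ> flip_on {..<n}) = sign f * sign (flip_on {..<n})"
    by (rule sign_compose)
  moreover have "sign f = -1"
    using sign_eq_num_cycles[OF _ f(1)] 1 by (simp add: card_cartesian_product)
  moreover have "sign (f \<circ> flip_on {..<n}) = (-1) ^ ?F"
    using sign_eq_num_cycles[OF _ permutes_compose[OF t f(1)]] by (simp add: card_cartesian_product power_add)
  ultimately have "(-1) ^ ?F = (-1) ^ (n + 1) * (1 :: int)"
    by (simp add: sign_flip_on)
  then have "even ?F = even (n + 1)" by (cases "even ?F"; cases "even n") auto
  then have "even (n + 1 - ?F)" using le by simp
  then obtain k where "n + 1 - ?F = 2 * k" by (rule evenE)
  then show ?thesis using le assms(1) by (auto simp: has_genus_bouquet_iff intro!: exI[of _ k])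
qed

lemma average_genus_bouquet:
  assumes "n \<ge> 1"
  shows "average_genus (bouquet n) (bouquet_rev n) = (real n + 1) / 2
    - (\<Sum>m<n. (1 + (-1) ^ m) / (2 * (real m + 1))) - (1 + (-1) ^ n) / (4 * (real n + 1))"
proof -
  let ?D = "{..<n} \<times> (UNIV :: bool set)"
  let ?F = "\<lambda>f. num_cycles ?D (f \<circ> flip_on {..<n})"
  let ?R = "rotation_systems (bouquet n)"
  let ?N = "num_embeddings (bouquet n) (bouquet_rev n)"
  let ?K = "{k. ?N k \<noteq> 0}"
  \<comment> \<open>On rotation systems this division is exact, so \<open>gen f\<close> is the
    genus.\<close>
  define gen where "gen f = (n + 1 - ?F f) div 2" for f
  have R: "?R = {f. f permutes ?D \<and> cyclic_on f ?D}"
    by (rule rotation_systems_bouquet[OF assms])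
  have "finite {f. f permutes ?D}" by (intro finite_permutations) simp
  then have finR: "finite ?R" unfolding R by (rule finite_subset[rotated]) auto
  have gen: "?F f + 2 * gen f = n + 1" "has_genus (bouquet n) (bouquet_rev n) f k \<longleftrightarrow> gen f = k"
    if f: "f \<in> ?R" for f k
  proof -
    obtain j where j: "?F f + 2 * j = n + 1"
      using ex_genus_bouquet[OF assms f] unfolding has_genus_bouquet_iff[OF assms] by blast
    then have "n + 1 - ?F f = 2 * j" by linarith
    then have "gen f = j" by (simp add: gen_def)
    then show "?F f + 2 * gen f = n + 1" "has_genus (bouquet n) (bouquet_rev n) f k \<longleftrightarrow> gen f = k"
      using j unfolding has_genus_bouquet_iff[OF assms] by linarith+
  qed
  have N: "?N k = card {f \<in> ?R. gen f = k}" for k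
    unfolding num_embeddings_def using gen(2) by (intro arg_cong[where f=card]) auto
  have finK: "finite ?K" by (rule finite_num_embeddings_support)
  \<comment> \<open>Sums over the genus become sums over rotation systems, grouped by their
    genus.\<close>
  have "gen ` ?R \<subseteq> ?K" using finR by (auto simp: N)
  then have group: "(\<Sum>k\<in>?K. \<Sum>f | f \<in> ?R \<and> gen f = k. h f) = (\<Sum>f\<in>?R. h f)" for h :: "_ \<Rightarrow> real"
    using finR finK by (intro sum.group) auto
  have cardR: "card ?R = fact (2 * n - 1)"
  proof -
    have "(0, False) \<in> ?D" using assms by simp
    then have "?D \<noteq> {}" by blast
    then have "card ?R = fact (card ?D - 1)" unfolding R by (intro card_cyclic_on) simp
    moreover have "card ?D = 2 * n" by (simp add: card_cartesian_product)
    ultimately show ?thesis by (simp only:)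
  qed
  have "poly (genus_polynomial (bouquet n) (bouquet_rev n)) 1 = (\<Sum>k\<in>?K. real (?N k))"
    by (simp add: genus_polynomial_def poly_sum poly_monom)
  also have "\<dots> = (\<Sum>k\<in>?K. \<Sum>f | f \<in> ?R \<and> gen f = k. 1)"
    by (simp add: N)
  also have "\<dots> = real (card ?R)" by (subst group) simp
  finally have 1: "poly (genus_polynomial (bouquet n) (bouquet_rev n)) 1 = fact (2 * n - 1)"
    by (simp add: cardR)
  have "poly (pderiv (genus_polynomial (bouquet n) (bouquet_rev n))) 1 = (\<Sum>k\<in>?K. real k * real (?N k))"
    by (simp add: genus_polynomial_def higher_pderiv_sum[of 1, simplified] poly_sum poly_monom
        pderiv_monom)
  also have "\<dots> = (\<Sum>k\<in>?K. \<Sum>f | f \<in> ?R \<and> gen f = k. real (gen f))"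
    by (simp add: N mult.commute)
  also have "\<dots> = (\<Sum>f\<in>?R. real (gen f))" by (rule group)
  \<comment> \<open>The genus is affine in the number of faces, so the total number of faces
    determines its average.\<close>
  also have "\<dots> = (\<Sum>f\<in>?R. (real n + 1) / 2 - real (?F f) / 2)"
  proof (intro sum.cong refl)
    fix f assume "f \<in> ?R"
    then have "real (?F f + 2 * gen f) = real (n + 1)" using gen(1) by simp
    then show "real (gen f) = (real n + 1) / 2 - real (?F f) / 2"
      by (simp add: field_simps)
  qed
  also have "\<dots> = fact (2 * n - 1) * ((real n + 1) / 2) - (\<Sum>f\<in>?R. real (?F f)) / 2"
    by (simp add: sum_subtractf sum_divide_distrib cardR)
  also have "(\<Sum>f\<in>?R. real (?F f)) = fact (2 * n - 1) * ((\<Sum>m<n. (1 + (-1) ^ m) / (real m + 1)) +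
      (1 + (-1) ^ n) / (2 * (real n + 1)))"
    unfolding R expected_num_cycles[OF assms] harm_minus_sum_hook_coeff[OF assms] ..
  also have "fact (2 * n - 1) * ((real n + 1) / 2) - fact (2 * n - 1) * ((\<Sum>m<n. (1 + (-1) ^ m) / (real m + 1)) +
      (1 + (-1) ^ n) / (2 * (real n + 1))) / 2 =
      fact (2 * n - 1) * ((real n + 1) / 2 - (\<Sum>m<n. (1 + (-1) ^ m) / (real m + 1)) / 2 -
        (1 + (-1) ^ n) / (4 * (real n + 1)))"
    by (simp add: right_diff_distrib distrib_left add_divide_distrib)
  finally have 2: "poly (pderiv (genus_polynomial (bouquet n) (bouquet_rev n))) 1 =
      fact (2 * n - 1) * ((real n + 1) / 2 - (\<Sum>m<n. (1 + (-1) ^ m) / (real m + 1)) / 2 -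
        (1 + (-1) ^ n) / (4 * (real n + 1)))" .
  have "(\<Sum>m<n. (1 + (-1) ^ m) / (real m + 1)) / 2 = (\<Sum>m<n. (1 + (-1) ^ m) / (2 * (real m + 1)))"
    by (simp add: sum_divide_distrib mult.commute)
  then show ?thesis
    unfolding average_genus_def 1 2 by simp
qed

section \<open>Asymptotics of the average genus\<close>

lemma average_genus_bouquet_asymptotics:
  "(\<lambda>n. average_genus (bouquet n) (bouquet_rev n)
      - (real n - ln (real n) - euler_mascheroni + 1 - ln 2) / 2) \<in> o(\<lambda>_. 1)"
proof (rule smalloI_tendsto)
  \<comment> \<open>The exact error for \<open>n >= 1\<close>, arranged in three summands that each
    tend to zero.\<close>
  let ?e = "\<lambda>n. (euler_mascheroni - (harm n - ln (real n))) / 2 + (ln 2 - (\<Sum>m<n. (-1) ^ m / real (Suc m))) / 2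
      - (1 + (-1) ^ n) / (4 * (real n + 1))"
  have "(\<lambda>n. (1 + (-1) ^ n) / (4 * (real n + 1))) \<longlonglongrightarrow> 0"
  proof (rule Lim_null_comparison)
    show "\<forall>\<^sub>F n in sequentially. norm ((1 + (-1) ^ n) / (4 * (real n + 1))) \<le> inverse (real (Suc n))"
      by (intro always_eventually allI) (auto simp: minus_one_power_iff field_simps)
    show "(\<lambda>n. inverse (real (Suc n))) \<longlonglongrightarrow> 0" by (rule LIMSEQ_inverse_real_of_nat)
  qed
  moreover have "(\<lambda>n. \<Sum>m<n. (-1) ^ m / real (Suc m)) \<longlonglongrightarrow> ln 2"
    using alternating_harmonic_series_sums by (simp add: sums_def)
  moreover have "(\<lambda>n. harm n - ln (real n)) \<longlonglongrightarrow> euler_mascheroni"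
    using euler_mascheroni_LIMSEQ by simp
  ultimately have "?e \<longlonglongrightarrow> (euler_mascheroni - euler_mascheroni) / 2 + (ln 2 - ln 2) / 2 - 0"
    by (intro tendsto_intros) simp_all
  then have "?e \<longlonglongrightarrow> 0" by simp
  moreover have "\<forall>\<^sub>F n in sequentially. ?e n = (average_genus (bouquet n) (bouquet_rev n)
      - (real n - ln (real n) - euler_mascheroni + 1 - ln 2) / 2) / 1"
  proof (rule eventually_sequentiallyI[of 1])
    fix n :: nat assume n: "n \<ge> 1"
    \<comment> \<open>Half a harmonic sum and half an alternating one: the first yields
      \<open>ln n\<close> and the Euler constant, the second \<open>ln 2\<close>.\<close>
    have "(\<Sum>m<n. (1 + (-1) ^ m) / (2 * (real m + 1))) =
        (\<Sum>m<n. inverse (real (Suc m)) / 2 + ((-1) ^ m / real (Suc m)) / 2)"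
      by (intro sum.cong refl) (simp add: field_simps)
    also have "\<dots> = harm n / 2 + (\<Sum>m<n. (-1) ^ m / real (Suc m)) / 2"
      by (simp only: harm_altdef sum.distrib sum_divide_distrib)
    finally show "?e n = (average_genus (bouquet n) (bouquet_rev n)
      - (real n - ln (real n) - euler_mascheroni + 1 - ln 2) / 2) / 1"
      unfolding average_genus_bouquet[OF n] by (simp add: field_simps)
  qed
  ultimately show "(\<lambda>n. (average_genus (bouquet n) (bouquet_rev n)
      - (real n - ln (real n) - euler_mascheroni + 1 - ln 2) / 2) / 1) \<longlonglongrightarrow> 0"
    by (rule Lim_transform_eventually)
qed simp

theorem theorem2p1:
  shows "(\<forall>n::nat. n \<ge> 1 \<longrightarrow>
            average_genus (bouquet n) (bouquet_rev n) =
              (real n + 1) / 2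
              - (\<Sum>m=0..n-1. (1 + (-1) ^ m) / (2 * (real m + 1)))
              - (1 + (-1) ^ n) / (4 * (real n + 1)))
       \<and> (\<lambda>n::nat. average_genus (bouquet n) (bouquet_rev n)
              - (real n - ln (real n) - euler_mascheroni + 1 - ln 2) / 2)
            \<in> o[at_top](\<lambda>_. 1 :: real)"
proof (intro conjI allI impI)
  fix n :: nat assume n: "n \<ge> 1"
  then have "{0..n - 1} = {..<n}" by auto
  with average_genus_bouquet[OF n]
  show "average_genus (bouquet n) (bouquet_rev n) =
              (real n + 1) / 2
              - (\<Sum>m=0..n-1. (1 + (-1) ^ m) / (2 * (real m + 1)))
              - (1 + (-1) ^ n) / (4 * (real n + 1))"
    by simp
qed (rule average_genus_bouquet_asymptotics)

end
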